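(* Let $d>2$, and let $(X,\rho,\mu)$ be an Ahlfors $d$-regular metric measure space. If $T$ is a $\mu$-singular integral operator (with $\mu$-singular kernel $K$), then for every measurable $b:X\to\mathbb C$, $$\|[b,T]\|_{S^{d,\infty}(L^2(\mu))}\lesssim\|b\|_{\dot M^{1,d}(\mu)},$$ where the implied constant is independent of $b$.
   Context: $(X,\rho,\mu)$ is Ahlfors $d$-regular if $\mu(B(x,r))\sim r^d$ for all $x\in X$, $r>0$ (two-sided bounds with uniform constants). Let $V(x,y):=\mu(B(x,\rho(x,y)))$. A measurable function $K$ on $\{(x,y)\in X\times X:x\ne y\}$ is a $\mu$-singular kernel if $|K(x,y)|\lesssim1/V(x,y)$; no regularity of $K$ and no boundedness of $T$ is assumed. A $\mu$-singular integral operator $T$ is an operator with such a kernel $K$, and $[b,T]=bT-Tb$ is the integral operator with kernel $(b(x)-b(y))K(x,y)$, i.e. $[b,T]f(x)=\int_X(b(x)-b(y))K(x,y)f(y)\,d\mu(y)$ (part of the assertion is that this defines a bounded operator on $L^2(\mu)$ when the right-hand side of the claim is finite). $h:X\to[0,\infty]$ is a Hajłasz upper gradient of $b$ if $|b(x)-b(y)|\le\rho(x,y)(h(x)+h(y))$ for almost all $x,y\in X$; $\|b\|_{\dot M^{1,d}(\mu)}$ is the infimum of $\|h\|_{L^d(\mu)}$ over all Hajłasz upper gradients $h$ of $b$ ($+\infty$ if there is none in $L^d(\mu)$). For a bounded operator $R$ on a Hilbert space $\mathcal H$, $a_n(R)=\inf\{\|R-F\|:\operatorname{rank}F<n\}$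 and $\|R\|_{S^{p,\infty}(\mathcal H)}=\sup_{n\ge1}n^{1/p}a_n(R)$. *)

theory Defs
  imports "HOL-Analysis.Analysis"
begin

section \<open>Metric measure spaces and singular kernels\<close>

text \<open>The metric space is the type \<open>'a\<close>. The \<open>\<sigma>\<close>-algebra of the measure is only required to
  contain the Borel sets, so that a Borel measure and its completion are both covered; this forces
  \<open>space M = UNIV\<close>.\<close>

definition ahlfors_regular :: "'a::metric_space measure \<Rightarrow> real \<Rightarrow> bool" where
  "ahlfors_regular M d \<longleftrightarrow>
     sets borel \<subseteq> sets M \<and>
     (\<exists>c>0. \<exists>C>0. \<forall>x. \<forall>r>0.
        ennreal (c * r powr d) \<le> emeasure M (ball x r) \<and>
        emeasure M (ball x r) \<le> ennreal (C * r powr d))"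

definition vol :: "'a::metric_space measure \<Rightarrow> 'a \<Rightarrow> 'a \<Rightarrow> ennreal" where
  "vol M x y = emeasure M (ball x (dist x y))"

text \<open>A kernel is a total function, but its values on the diagonal are unconstrained.\<close>

definition singular_kernel :: "'a::metric_space measure \<Rightarrow> ('a \<Rightarrow> 'a \<Rightarrow> complex) \<Rightarrow> bool" where
  "singular_kernel M K \<longleftrightarrow>
     (\<lambda>(x, y). K x y) \<in> borel_measurable (restrict_space (M \<Otimes>\<^sub>M M) {(x, y). x \<noteq> y}) \<and>
     (\<exists>C>0::real. \<forall>x y. x \<noteq> y \<longrightarrow> ennreal (cmod (K x y)) \<le> ennreal C / vol M x y)"

text \<open>A singular integral operator \<open>T\<close> enters only through its kernel \<open>K\<close>: the commutator
  \<open>[b, T]\<close> is by definition the integral operator with kernel \<open>(b x - b y) K x y\<close>. The Bochner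
  integral is \<open>0\<close> by convention where the integrand is not integrable, so convergence has to be
  claimed separately; that is the purpose of \<open>commutator_converges\<close> below.\<close>

definition commutator ::
  "'a measure \<Rightarrow> ('a \<Rightarrow> 'a \<Rightarrow> complex) \<Rightarrow> ('a \<Rightarrow> complex) \<Rightarrow> ('a \<Rightarrow> complex) \<Rightarrow> 'a \<Rightarrow> complex" where
  "commutator M K b f x = (\<integral>y. (b x - b y) * K x y * f y \<partial>M)"


section \<open>Lebesgue norms and the Hajlasz seminorm\<close>

text \<open>Intended for exponents \<open>p > 0\<close>.\<close>

definition enn_powr :: "ennreal \<Rightarrow> real \<Rightarrow> ennreal" where
  "enn_powr a p = (if a = \<infinity> then \<infinity> else ennreal (enn2real a powr p))"

definition Lnorm :: "'a measure \<Rightarrow> real \<Rightarrow> ('a \<Rightarrow> ennreal) \<Rightarrow> ennreal" where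
  "Lnorm M p h = enn_powr (\<integral>\<^sup>+ x. enn_powr (h x) p \<partial>M) (1 / p)"

definition hajlasz_upper_gradient ::
  "'a::metric_space measure \<Rightarrow> ('a \<Rightarrow> complex) \<Rightarrow> ('a \<Rightarrow> ennreal) \<Rightarrow> bool" where
  "hajlasz_upper_gradient M b h \<longleftrightarrow>
     h \<in> borel_measurable M \<and>
     (AE (x, y) in M \<Otimes>\<^sub>M M. ennreal (cmod (b x - b y)) \<le> ennreal (dist x y) * (h x + h y))"

definition hajlasz_norm :: "'a::metric_space measure \<Rightarrow> real \<Rightarrow> ('a \<Rightarrow> complex) \<Rightarrow> ennreal" where
  "hajlasz_norm M d b = (INF h \<in> {h. hajlasz_upper_gradient M b h}. Lnorm M d h)"


section \<open>Operators on \<open>L\<^sup>2\<close>, approximation numbers and weak Schatten norms\<close>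

text \<open>Elements of \<open>L\<^sup>2\<close> are represented by functions, and all identities between them are understood
  almost everywhere.\<close>

definition L2norm :: "'a measure \<Rightarrow> ('a \<Rightarrow> complex) \<Rightarrow> ennreal" where
  "L2norm M f = Lnorm M 2 (\<lambda>x. ennreal (cmod (f x)))"

definition L2 :: "'a measure \<Rightarrow> ('a \<Rightarrow> complex) set" where
  "L2 M = {f \<in> borel_measurable M. L2norm M f < \<infinity>}"

definition op_norm :: "'a measure \<Rightarrow> (('a \<Rightarrow> complex) \<Rightarrow> 'a \<Rightarrow> complex) \<Rightarrow> ennreal" where
  "op_norm M R = (SUP f \<in> {f \<in> L2 M. L2norm M f \<le> 1}. L2norm M (R f))"

text \<open>Compatibility of \<open>R\<close> with equality almost everywhere is a consequence of linearity and
  boundedness, so every such \<open>R\<close> induces an operator on the quotient space.\<close>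

definition bounded_op :: "'a measure \<Rightarrow> (('a \<Rightarrow> complex) \<Rightarrow> 'a \<Rightarrow> complex) \<Rightarrow> bool" where
  "bounded_op M R \<longleftrightarrow>
     (\<forall>f \<in> L2 M. R f \<in> L2 M) \<and>
     (\<forall>a. \<forall>f \<in> L2 M. \<forall>g \<in> L2 M. AE x in M. R (\<lambda>x. a * f x + g x) x = a * R f x + R g x) \<and>
     op_norm M R < \<infinity>"

text \<open>The range of \<open>F\<close> has dimension less than \<open>n\<close>, i.e. it is contained in the span of
  \<open>m < n\<close> elements of \<open>L\<^sup>2\<close>.\<close>

definition rank_less :: "'a measure \<Rightarrow> (('a \<Rightarrow> complex) \<Rightarrow> 'a \<Rightarrow> complex) \<Rightarrow> nat \<Rightarrow> bool" where
  "rank_less M F n \<longleftrightarrow>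
     (\<exists>m<n. \<exists>g :: nat \<Rightarrow> 'a \<Rightarrow> complex. (\<forall>i<m. g i \<in> L2 M) \<and>
        (\<forall>f \<in> L2 M. \<exists>c :: nat \<Rightarrow> complex. AE x in M. F f x = (\<Sum>i<m. c i * g i x)))"

definition approx_number ::
  "'a measure \<Rightarrow> nat \<Rightarrow> (('a \<Rightarrow> complex) \<Rightarrow> 'a \<Rightarrow> complex) \<Rightarrow> ennreal" where
  "approx_number M n R =
     (INF F \<in> {F. bounded_op M F \<and> rank_less M F n}. op_norm M (\<lambda>f x. R f x - F f x))"

definition weak_schatten_norm ::
  "'a measure \<Rightarrow> real \<Rightarrow> (('a \<Rightarrow> complex) \<Rightarrow> 'a \<Rightarrow> complex) \<Rightarrow> ennreal" where
  "weak_schatten_norm M p R =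
     (SUP n \<in> {1..}. ennreal (real n powr (1 / p)) * approx_number M n R)"

definition commutator_converges ::
  "'a measure \<Rightarrow> ('a \<Rightarrow> 'a \<Rightarrow> complex) \<Rightarrow> ('a \<Rightarrow> complex) \<Rightarrow> bool" where
  "commutator_converges M K b \<longleftrightarrow>
     (\<forall>f \<in> L2 M. AE x in M. integrable M (\<lambda>y. (b x - b y) * K x y * f y))"

end

(* Given a Hajlasz gradient h of b with L^d norm at most N, the kernel of the commutator is
   dominated by (h x + h y) rho^(1-d), where rho = dist x y. With t = N n^(-1/d), split it where
   max (h x) (h y) * rho crosses t.

   The far part is Hilbert-Schmidt: summing over dyadic annuli, where d > 2 gives convergence, its
   squared norm is at most a constant times t^(2-d) N^d = n t^2, so its n-th approximation number
   is at most a constant times t.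

   The near part has operator norm at most a constant times t: it is dominated by t times a
   geometric series of averages A_r over balls B(x, r x) with a variable radius r, plus transposes.
   The operators A_r are bounded on L^2 uniformly in r, without any maximal function:
   A_r A_r^T is dominated by a constant times A_(2r) + A_(2r)^T, and iterating the resulting
   inequality between the norms at r and 2r removes an a priori bound, which Schur's test provides
   for radii in {0} and [s, s L]. That bound depends only on L, so it survives the doubling. *)

theory Submission
  imports Defs
begin

section \<open>Squares of \<open>L\<^sup>2\<close> norms\<close>

text \<open>The condition \<open>h x * rho < t\<close> describes a ball of radius
  \<open>t / h x\<close>, and \<open>h\<close> has no regularity; this is why averages with an
  arbitrary measurable radius appear. Balls of very different sizes may overlap, so the transposed
  averages are not of the same form as the averages.

  If \<open>X_r\<close> denotes the best squared bound for the transpose at radius \<open>r\<close>,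
  the composition estimate yields \<open>X_r \<le> (c + X_(2 r)) / 2\<close>. This says nothing as
  long as \<open>X_(2^k r)\<close> may grow with \<open>k\<close> or be infinite. An a priori bound
  unaffected by the doubling leaves \<open>X_r \<le> c\<close>, duality passes to the averages
  themselves, and monotone convergence reaches all radii.

  Approximation numbers of a Hilbert-Schmidt operator are estimated without singular values: if
  every operator of rank below \<open>n\<close> is far away, there are \<open>n\<close> orthonormal
  vectors with large images, against Bessel's inequality.

  Norms are squared throughout. Sums then cost a factor 2, and all estimates remain inequalities
  between integrals in \<open>ennreal\<close>.\<close>

definition L2sq :: "'a measure \<Rightarrow> ('a \<Rightarrow> complex) \<Rightarrow> ennreal" where
  "L2sq M f = (\<integral>\<^sup>+ x. (ennreal (cmod (f x)))\<^sup>2 \<partial>M)"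

lemma enn_powr_2 [simp]: "enn_powr (ennreal (norm z)) 2 = (ennreal (norm z))\<^sup>2"
  by (simp add: enn_powr_def ennreal_power)

lemma L2norm_eq: "L2norm M f = enn_powr (L2sq M f) (1 / 2)"
  by (simp add: L2norm_def Lnorm_def L2sq_def)

lemma L2norm_le_iff:
  assumes "0 \<le> s"
  shows "L2norm M f \<le> ennreal s \<longleftrightarrow> L2sq M f \<le> ennreal (s\<^sup>2)"
proof (cases "L2sq M f")
  case (real i)
  then have "L2norm M f \<le> ennreal s \<longleftrightarrow> sqrt i \<le> s"
    using assms by (simp add: L2norm_eq enn_powr_def powr_half_sqrt)
  also have "\<dots> \<longleftrightarrow> i \<le> s\<^sup>2"
    using assms real by (metis real_le_rsqrt real_le_lsqrt real_sqrt_ge_zero real_sqrt_le_iff real_sqrt_unique)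
  finally show ?thesis using real assms by simp
qed (simp add: L2norm_eq enn_powr_def top_unique)

lemma L2_iff: "f \<in> L2 M \<longleftrightarrow> f \<in> borel_measurable M \<and> L2sq M f < \<infinity>"
  by (auto simp: L2_def L2norm_eq enn_powr_def less_top)

lemma op_norm_le_iff:
  assumes "0 \<le> s"
  shows "op_norm M R \<le> ennreal s \<longleftrightarrow>
    (\<forall>f\<in>L2 M. L2sq M f \<le> 1 \<longrightarrow> L2sq M (R f) \<le> ennreal (s\<^sup>2))"
  using L2norm_le_iff[of 1 M]
  by (auto simp: op_norm_def SUP_le_iff L2norm_le_iff[OF assms])

lemma square_sum_le_ennreal: "(a + b)\<^sup>2 \<le> 2 * a\<^sup>2 + 2 * (b\<^sup>2 :: ennreal)"
proof (cases a; cases b)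
  fix r s :: real assume *: "0 \<le> r" "0 \<le> s" "a = ennreal r" "b = ennreal s"
  have "(r + s)\<^sup>2 \<le> 2 * r\<^sup>2 + 2 * s\<^sup>2"
    using zero_le_power2[of "r - s"] by (simp add: power2_eq_square algebra_simps)
  then have "ennreal ((r + s)\<^sup>2) \<le> ennreal (2 * r\<^sup>2 + 2 * s\<^sup>2)"
    by (rule ennreal_leI)
  moreover have "(a + b)\<^sup>2 = ennreal ((r + s)\<^sup>2)"
    using * by (simp add: ennreal_power flip: ennreal_plus)
  ultimately show ?thesis
    using * by (simp add: ennreal_power ennreal_mult)
qed (auto simp: power2_eq_square ennreal_mult_top ennreal_top_mult)

lemma mult_le_squares_ennreal: "2 * (a * b) \<le> a\<^sup>2 + (b\<^sup>2 :: ennreal)"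
proof (cases a; cases b)
  fix r s :: real assume *: "0 \<le> r" "0 \<le> s" "a = ennreal r" "b = ennreal s"
  have "2 * (r * s) \<le> r\<^sup>2 + s\<^sup>2"
    using zero_le_power2[of "r - s"] by (simp add: power2_eq_square algebra_simps)
  then have "ennreal (2 * (r * s)) \<le> ennreal (r\<^sup>2 + s\<^sup>2)"
    by (rule ennreal_leI)
  then show ?thesis
    using * by (simp add: ennreal_power ennreal_mult)
qed (auto simp: power2_eq_square ennreal_mult_top ennreal_top_mult)

lemma L2sq_cong_AE: "AE x in M. f x = g x \<Longrightarrow> L2sq M f = L2sq M g"
  unfolding L2sq_def by (rule nn_integral_cong_AE) auto

text \<open>The pointwise bound on \<open>(a + b)^2\<close> replaces Minkowski's inequality; the
  factor 2 ends up in the final constant.\<close>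

lemma L2sq_add_le:
  assumes [measurable]: "f \<in> borel_measurable M" "g \<in> borel_measurable M"
  shows "L2sq M (\<lambda>x. f x + g x) \<le> 2 * L2sq M f + 2 * L2sq M g"
proof -
  have "L2sq M (\<lambda>x. f x + g x) \<le>
      (\<integral>\<^sup>+ x. 2 * (ennreal (cmod (f x)))\<^sup>2 + 2 * (ennreal (cmod (g x)))\<^sup>2 \<partial>M)"
    unfolding L2sq_def
  proof (rule nn_integral_mono)
    fix x
    have "ennreal (cmod (f x + g x)) \<le> ennreal (cmod (f x)) + ennreal (cmod (g x))"
      by (simp add: ennreal_plus[symmetric] norm_triangle_ineq del: ennreal_plus)
    then have "(ennreal (cmod (f x + g x)))\<^sup>2 \<le> (ennreal (cmod (f x)) + ennreal (cmod (g x)))\<^sup>2"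
      by (rule power_mono) simp
    also note square_sum_le_ennreal
    finally show "(ennreal (cmod (f x + g x)))\<^sup>2
      \<le> 2 * (ennreal (cmod (f x)))\<^sup>2 + 2 * (ennreal (cmod (g x)))\<^sup>2" .
  qed
  also have "\<dots> = 2 * L2sq M f + 2 * L2sq M g"
    unfolding L2sq_def by (subst nn_integral_add) (auto simp: nn_integral_cmult)
  finally show ?thesis .
qed

lemma L2sq_scale:
  assumes [measurable]: "f \<in> borel_measurable M"
  shows "L2sq M (\<lambda>x. a * f x) = (ennreal (cmod a))\<^sup>2 * L2sq M f"
  unfolding L2sq_def by (simp add: norm_mult ennreal_mult power_mult_distrib nn_integral_cmult)

lemma L2_zero: "(\<lambda>x. 0) \<in> L2 M"
  by (simp add: L2_iff L2sq_def)

lemma L2_scale: "f \<in> L2 M \<Longrightarrow> (\<lambda>x. a * f x) \<in> L2 M"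
  by (auto simp: L2_iff L2sq_scale ennreal_mult_less_top ennreal_power)

lemma L2_add:
  assumes "f \<in> L2 M" "g \<in> L2 M"
  shows "(\<lambda>x. f x + g x) \<in> L2 M"
proof -
  have [measurable]: "f \<in> borel_measurable M" "g \<in> borel_measurable M"
    using assms by (auto simp: L2_iff)
  have "2 * L2sq M f + 2 * L2sq M g < \<infinity>"
    using assms by (auto simp: L2_iff ennreal_mult_less_top)
  then show ?thesis
    using L2sq_add_le[of f M g] by (auto simp: L2_iff intro: le_less_trans)
qed

lemma L2_sum:
  fixes m :: nat
  shows "(\<And>i. i < m \<Longrightarrow> f i \<in> L2 M) \<Longrightarrow> (\<lambda>x. \<Sum>i<m. c i * f i x) \<in> L2 M"
  by (induction m) (auto intro!: L2_zero L2_add L2_scale)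

lemma L2_diff: "f \<in> L2 M \<Longrightarrow> g \<in> L2 M \<Longrightarrow> (\<lambda>x. f x - g x) \<in> L2 M"
  using L2_add[OF _ L2_scale[of g M "-1"], of f] by simp

lemma borel_measurable_cnj [measurable]: "cnj \<in> borel_measurable borel"
  by (intro borel_measurable_continuous_onI continuous_intros)

section \<open>Orthonormal families in \<open>L\<^sup>2\<close>\<close>

definition ip :: "'a measure \<Rightarrow> ('a \<Rightarrow> complex) \<Rightarrow> ('a \<Rightarrow> complex) \<Rightarrow> complex" where
  "ip M f g = (\<integral>x. f x * cnj (g x) \<partial>M)"

lemma integrable_ip:
  assumes "f \<in> L2 M" "g \<in> L2 M"
  shows "integrable M (\<lambda>x. f x * cnj (g x))"
proof (rule integrableI_bounded)
  have [measurable]: "f \<in> borel_measurable M" "g \<in> borel_measurable M"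
    using assms by (auto simp: L2_iff)
  show "(\<lambda>x. f x * cnj (g x)) \<in> borel_measurable M" by measurable
  have "(\<integral>\<^sup>+ x. ennreal (norm (f x * cnj (g x))) \<partial>M)
      \<le> (\<integral>\<^sup>+ x. (ennreal (cmod (f x)))\<^sup>2 + (ennreal (cmod (g x)))\<^sup>2 \<partial>M)"
  proof (rule nn_integral_mono)
    fix x
    have "ennreal (norm (f x * cnj (g x))) = ennreal (cmod (f x)) * ennreal (cmod (g x))"
      by (simp add: norm_mult ennreal_mult)
    also have "\<dots> \<le> 2 * (ennreal (cmod (f x)) * ennreal (cmod (g x)))"
      by (simp add: mult_2)
    also note mult_le_squares_ennreal
    finally show "ennreal (norm (f x * cnj (g x)))
      \<le> (ennreal (cmod (f x)))\<^sup>2 + (ennreal (cmod (g x)))\<^sup>2" .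
  qed
  also have "\<dots> = L2sq M f + L2sq M g"
    unfolding L2sq_def by (subst nn_integral_add) auto
  also have "\<dots> < \<infinity>" using assms by (auto simp: L2_iff)
  finally show "(\<integral>\<^sup>+ x. ennreal (norm (f x * cnj (g x))) \<partial>M) < \<infinity>" .
qed

lemma ip_cnj: "cnj (ip M f g) = ip M g f"
  unfolding ip_def by (subst Bochner_Integration.integral_cnj[symmetric]) (simp add: mult.commute)

lemma ip_add_scale:
  assumes "f \<in> L2 M" "g \<in> L2 M" "u \<in> L2 M"
  shows "ip M (\<lambda>x. a * f x + g x) u = a * ip M f u + ip M g u"
  using integrable_ip[OF assms(1,3)] integrable_ip[OF assms(2,3)]
  unfolding ip_def by (simp add: distrib_right mult.assoc)

lemma ip_diff:
  assumes "f \<in> L2 M" "g \<in> L2 M" "u \<in> L2 M"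
  shows "ip M (\<lambda>x. f x - g x) u = ip M f u - ip M g u"
  using ip_add_scale[of g M f u "-1"] assms by simp

lemma ip_scale_left: "ip M (\<lambda>x. a * f x) g = a * ip M f g"
  unfolding ip_def by (simp add: mult.assoc)

lemma ip_scale_right: "ip M f (\<lambda>x. a * g x) = cnj a * ip M f g"
  using ip_scale_left[of M a g f] by (metis ip_cnj complex_cnj_mult)

lemma ip_sum:
  fixes m :: nat
  assumes "\<And>i. i < m \<Longrightarrow> f i \<in> L2 M" "u \<in> L2 M"
  shows "ip M (\<lambda>x. \<Sum>i<m. c i * f i x) u = (\<Sum>i<m. c i * ip M (f i) u)"
  using assms(1)
proof (induction m)
  case 0 then show ?case by (simp add: ip_def)
next
  case (Suc m)
  have "ip M (\<lambda>x. c m * f m x + (\<Sum>i<m. c i * f i x)) u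
      = c m * ip M (f m) u + ip M (\<lambda>x. \<Sum>i<m. c i * f i x) u"
    using Suc.prems assms(2) by (intro ip_add_scale L2_sum) auto
  then show ?case using Suc by (simp add: add.commute)
qed

lemma ip_self:
  assumes "f \<in> L2 M"
  shows "ennreal (Re (ip M f f)) = L2sq M f" "Im (ip M f f) = 0"
proof -
  have int: "integrable M (\<lambda>x. complex_of_real ((cmod (f x))\<^sup>2))"
    using integrable_ip[OF assms assms] by (simp add: complex_norm_square del: of_real_power)
  have eq: "ip M f f = complex_of_real (\<integral>x. (cmod (f x))\<^sup>2 \<partial>M)"
    unfolding ip_def by (simp add: complex_norm_square[symmetric] del: of_real_power)
  have "L2sq M f = ennreal (\<integral>x. (cmod (f x))\<^sup>2 \<partial>M)"
    unfolding L2sq_def ennreal_power[OF norm_ge_zero]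
    using integrable_Re[OF int] by (intro nn_integral_eq_integral) (auto simp del: of_real_power)
  then show "ennreal (Re (ip M f f)) = L2sq M f" "Im (ip M f f) = 0"
    unfolding eq by simp_all
qed

definition orthonormal :: "'a measure \<Rightarrow> nat \<Rightarrow> (nat \<Rightarrow> 'a \<Rightarrow> complex) \<Rightarrow> bool" where
  "orthonormal M m e \<longleftrightarrow> (\<forall>i<m. e i \<in> L2 M) \<and>
     (\<forall>i<m. \<forall>j<m. ip M (e i) (e j) = (if i = j then 1 else 0))"

definition proj :: "'a measure \<Rightarrow> nat \<Rightarrow> (nat \<Rightarrow> 'a \<Rightarrow> complex) \<Rightarrow> ('a \<Rightarrow> complex) \<Rightarrow> 'a \<Rightarrow> complex" where
  "proj M m e f = (\<lambda>x. \<Sum>i<m. ip M f (e i) * e i x)"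

lemma proj_L2: "orthonormal M m e \<Longrightarrow> proj M m e f \<in> L2 M"
  unfolding proj_def orthonormal_def by (intro L2_sum) auto

lemma proj_linear:
  assumes "orthonormal M m e" "f \<in> L2 M" "g \<in> L2 M"
  shows "proj M m e (\<lambda>x. a * f x + g x) = (\<lambda>x. a * proj M m e f x + proj M m e g x)"
  using assms unfolding proj_def orthonormal_def
  by (intro ext) (simp add: ip_add_scale sum_distrib_left distrib_right mult.assoc sum.distrib)

lemma ip_diff_proj:
  assumes e: "orthonormal M m e" and f: "f \<in> L2 M" and i: "i < m"
  shows "ip M (\<lambda>x. f x - proj M m e f x) (e i) = 0"
proof -
  have "ip M (proj M m e f) (e i) = (\<Sum>j<m. ip M f (e j) * ip M (e j) (e i))"
    unfolding proj_def using e i by (intro ip_sum) (auto simp: orthonormal_def)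
  also have "\<dots> = (\<Sum>j<m. if j = i then ip M f (e j) else 0)"
    using e i by (intro sum.cong) (auto simp: orthonormal_def)
  also have "\<dots> = ip M f (e i)" using i by simp
  finally show ?thesis
    using e i by (subst ip_diff[OF f proj_L2]) (auto simp: orthonormal_def)
qed

text \<open>Pythagoras: the residual is orthogonal to every \<open>e i\<close>. Dropping one
  nonnegative term or the other gives Bessel's inequality and the contraction property of the
  residual.\<close>

lemma L2sq_diff_proj:
  assumes e: "orthonormal M m e" and f: "f \<in> L2 M"
  shows "L2sq M f = L2sq M (\<lambda>x. f x - proj M m e f x) + (\<Sum>i<m. ennreal ((cmod (ip M f (e i)))\<^sup>2))"
proof -
  define g where "g = (\<lambda>x. f x - proj M m e f x)"
  have g: "g \<in> L2 M" unfolding g_def using e f by (intro L2_diff proj_L2)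
  have "ip M (proj M m e f) g = (\<Sum>i<m. ip M f (e i) * ip M (e i) g)"
    unfolding proj_def using e g by (intro ip_sum) (auto simp: orthonormal_def)
  also have "\<dots> = 0"
  proof (intro sum.neutral ballI)
    fix i assume "i \<in> {..<m}"
    then have "ip M g (e i) = 0"
      unfolding g_def using ip_diff_proj[OF e f] by simp
    then show "ip M f (e i) * ip M (e i) g = 0"
      using ip_cnj[of M g "e i"] by simp
  qed
  finally have pg: "ip M (proj M m e f) g = 0" .
  have "ip M g g = ip M f g - ip M (proj M m e f) g"
    using ip_diff[OF f proj_L2[OF e] g] unfolding g_def .
  \<comment> \<open>The residual is orthogonal to the projection, so one copy of \<open>g\<close>
    may be replaced by \<open>f\<close>; expanding the other copy produces the coefficients of
    \<open>f\<close>.\<close>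
  then have "ip M g g = ip M g f"
    using pg ip_cnj[of M g g] ip_cnj[of M f g] by simp
  also have "ip M g f = ip M f f - ip M (proj M m e f) f"
    unfolding g_def by (rule ip_diff[OF f proj_L2[OF e] f])
  also have "ip M (proj M m e f) f = (\<Sum>i<m. ip M f (e i) * ip M (e i) f)"
    unfolding proj_def using e f by (intro ip_sum) (auto simp: orthonormal_def)
  also have "\<dots> = (\<Sum>i<m. complex_of_real ((cmod (ip M f (e i)))\<^sup>2))"
    by (intro sum.cong refl, subst ip_cnj[symmetric]) (simp only: complex_norm_square)
  finally have "Re (ip M f f) = Re (ip M g g) + (\<Sum>i<m. (cmod (ip M f (e i)))\<^sup>2)"
    by (simp del: of_real_power)
  moreover have "0 \<le> Re (ip M g g)"
    by (auto simp: ip_def complex_norm_square[symmetric] simp del: of_real_power)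
  ultimately have "ennreal (Re (ip M f f)) = ennreal (Re (ip M g g)) + (\<Sum>i<m. ennreal ((cmod (ip M f (e i)))\<^sup>2))"
    by (simp add: sum_nonneg)
  then show ?thesis using ip_self(1)[OF f] ip_self(1)[OF g] by (simp add: g_def)
qed

lemma L2sq_diff_proj_le:
  "orthonormal M m e \<Longrightarrow> f \<in> L2 M \<Longrightarrow> L2sq M (\<lambda>x. f x - proj M m e f x) \<le> L2sq M f"
  using L2sq_diff_proj[of M m e f] by simp

lemma bessel_inequality:
  "orthonormal M m e \<Longrightarrow> f \<in> L2 M \<Longrightarrow> (\<Sum>i<m. ennreal ((cmod (ip M f (e i)))\<^sup>2)) \<le> L2sq M f"
  using L2sq_diff_proj[of M m e f] by simp

section \<open>Integral operators and their approximation numbers\<close>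

definition kop :: "'a measure \<Rightarrow> ('a \<Rightarrow> 'a \<Rightarrow> complex) \<Rightarrow> ('a \<Rightarrow> complex) \<Rightarrow> 'a \<Rightarrow> complex" where
  "kop M k f x = (\<integral>y. k x y * f y \<partial>M)"

text \<open>\<open>P\<close> bounds the square of the operator norm. Testing on
  \<open>ennreal\<close>-valued functions makes every integral meaningful, so that series, limits
  and Fubini raise no question of convergence; complex kernels enter through their modulus.\<close>

definition kbound :: "'a measure \<Rightarrow> ('a \<Rightarrow> 'a \<Rightarrow> ennreal) \<Rightarrow> ennreal \<Rightarrow> bool" where
  "kbound M \<kappa> P \<longleftrightarrow> (\<forall>f\<in>borel_measurable M.
     (\<integral>\<^sup>+x. (\<integral>\<^sup>+y. \<kappa> x y * f y \<partial>M)\<^sup>2 \<partial>M) \<le> P * (\<integral>\<^sup>+x. (f x)\<^sup>2 \<partial>M))"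

lemma kboundD:
  "kbound M \<kappa> P \<Longrightarrow> f \<in> borel_measurable M \<Longrightarrow>
     (\<integral>\<^sup>+x. (\<integral>\<^sup>+y. \<kappa> x y * f y \<partial>M)\<^sup>2 \<partial>M) \<le> P * (\<integral>\<^sup>+x. (f x)\<^sup>2 \<partial>M)"
  by (auto simp: kbound_def)

lemma bounded_op_L2: "bounded_op M R \<Longrightarrow> f \<in> L2 M \<Longrightarrow> R f \<in> L2 M"
  by (auto simp: bounded_op_def)

lemma bounded_op_linear:
  "bounded_op M R \<Longrightarrow> f \<in> L2 M \<Longrightarrow> g \<in> L2 M \<Longrightarrow>
    AE x in M. R (\<lambda>x. a * f x + g x) x = a * R f x + R g x"
  by (auto simp: bounded_op_def)

section \<open>Almost everywhere linearity of bounded operators\<close>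

lemma bounded_op_zero:
  assumes "bounded_op M R"
  shows "AE x in M. R (\<lambda>x. 0) x = 0"
  using bounded_op_linear[OF assms L2_zero L2_zero, of 1] by simp

lemma bounded_op_scale:
  assumes "bounded_op M R" "f \<in> L2 M"
  shows "AE x in M. R (\<lambda>x. a * f x) x = a * R f x"
  using bounded_op_linear[OF assms L2_zero, of a] bounded_op_zero[OF assms(1)] by eventually_elim simp

lemma bounded_op_diff:
  assumes "bounded_op M R" "f \<in> L2 M" "g \<in> L2 M"
  shows "AE x in M. R (\<lambda>x. f x - g x) x = R f x - R g x"
  using bounded_op_linear[OF assms(1,3,2), of "-1"] by eventually_elim simp

lemma bounded_op_sum:
  fixes m :: nat
  assumes "bounded_op M R" "\<And>i. i < m \<Longrightarrow> e i \<in> L2 M"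
  shows "AE x in M. R (\<lambda>x. \<Sum>i<m. c i * e i x) x = (\<Sum>i<m. c i * R (e i) x)"
  using assms(2)
proof (induction m)
  case 0
  then show ?case using bounded_op_zero[OF assms(1)] by simp
next
  case (Suc m)
  have "AE x in M. R (\<lambda>x. c m * e m x + (\<Sum>i<m. c i * e i x)) x
      = c m * R (e m) x + R (\<lambda>x. \<Sum>i<m. c i * e i x) x"
    using Suc.prems by (intro bounded_op_linear assms(1) L2_sum) auto
  moreover have "AE x in M. R (\<lambda>x. \<Sum>i<m. c i * e i x) x = (\<Sum>i<m. c i * R (e i) x)"
    using Suc by auto
  ultimately show ?case by eventually_elim (simp add: add.commute)
qed

lemma bounded_opI:
  assumes "\<And>f. f \<in> L2 M \<Longrightarrow> R f \<in> borel_measurable M"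
    and "\<And>a f g. f \<in> L2 M \<Longrightarrow> g \<in> L2 M \<Longrightarrow>
           AE x in M. R (\<lambda>x. a * f x + g x) x = a * R f x + R g x"
    and "\<And>f. f \<in> L2 M \<Longrightarrow> L2sq M (R f) \<le> P * L2sq M f" and "P < \<infinity>"
  shows "bounded_op M R"
  unfolding bounded_op_def
proof (intro conjI allI ballI)
  fix f assume f: "f \<in> L2 M"
  have "P * L2sq M f < \<infinity>"
    using assms(4) f by (auto simp: L2_iff ennreal_mult_less_top)
  then show "R f \<in> L2 M"
    using assms(1,3)[OF f] by (auto simp: L2_iff intro: le_less_trans)
next
  obtain p where p: "P = ennreal p" "0 \<le> p"
    using assms(4) by (cases P) auto
  have "op_norm M R \<le> ennreal (sqrt p)"
    using p by (subst op_norm_le_iff) (auto intro!: order_trans[OF assms(3)] simp: mult_left_le)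
  then show "op_norm M R < \<infinity>" by (simp add: le_less_trans)
qed (use assms(2) in auto)

text \<open>The bound \<open>L2sq M g \<le> 1\<close> makes the scaling factor at least 1, so
  normalizing \<open>g\<close> can only enlarge its image under a linear operator.\<close>

lemma L2_normalize:
  assumes g: "g \<in> L2 M" and g1: "L2sq M g \<le> 1" and g0: "L2sq M g \<noteq> 0"
  obtains a :: real where "1 \<le> a" "ip M (\<lambda>x. complex_of_real a * g x) (\<lambda>x. complex_of_real a * g x) = 1"
proof -
  obtain \<alpha> where \<alpha>: "L2sq M g = ennreal \<alpha>" "0 < \<alpha>" "\<alpha> \<le> 1"
    using g1 g0 by (cases "L2sq M g") (auto simp: order_less_le top_unique)
  have *: "ip M g g = complex_of_real \<alpha>"
    using ip_self[OF g] \<alpha>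
    by (cases "0 \<le> Re (ip M g g)") (auto simp: complex_eq_iff ennreal_neg)
  define a where "a = 1 / sqrt \<alpha>"
  have "1 \<le> a" "a * a * \<alpha> = 1"
    using \<alpha> by (auto simp: a_def field_simps)
  moreover from this(2) have "complex_of_real a * complex_of_real a * complex_of_real \<alpha> = 1"
    by (metis of_real_1 of_real_mult)
  ultimately show ?thesis
    using * by (intro that[of a]) (auto simp: ip_scale_left ip_scale_right mult.assoc)
qed

text \<open>Greedy construction. \<open>R\<close> composed with the projection onto the
  \<open>m < n\<close> vectors found so far has rank at most \<open>m\<close>, so by
  \<open>far\<close> it misses \<open>R\<close> on some \<open>f\<close>. The residual of
  \<open>f\<close> is orthogonal to these vectors and has a large image; normalized, it is the next
  vector.\<close>

lemma finite_rank_or_orthonormal: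
  assumes R: "bounded_op M R"
    and Rb: "\<And>f. f \<in> L2 M \<Longrightarrow> L2sq M (R f) \<le> P * L2sq M f" and P: "P < \<infinity>"
    and far: "\<And>F. bounded_op M F \<Longrightarrow> rank_less M F n \<Longrightarrow>
      \<exists>f\<in>L2 M. L2sq M f \<le> 1 \<and> s < L2sq M (\<lambda>x. R f x - F f x)"
  shows "m \<le> n \<Longrightarrow> \<exists>e. orthonormal M m e \<and> (\<forall>i<m. s < L2sq M (R (e i)))"
proof (induction m)
  case 0
  then show ?case by (simp add: orthonormal_def)
next
  case (Suc m)
  then obtain e where e: "orthonormal M m e" and es: "\<And>i. i < m \<Longrightarrow> s < L2sq M (R (e i))"
    by auto
  let ?p = "proj M m e"
  define F where "F f = R (?p f)" for f
  have pL2: "?p f \<in> L2 M" for f by (rule proj_L2[OF e])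
  \<comment> \<open>The projection is \<open>f\<close> minus its residual, whence the factor 4. Any
    finite factor serves, since the point is to make \<open>F\<close> bounded.\<close>
  have p_le: "L2sq M (?p f) \<le> 4 * L2sq M f" if f: "f \<in> L2 M" for f
  proof -
    have d: "(\<lambda>x. - 1 * (f x - ?p f x)) \<in> L2 M"
      by (intro L2_scale L2_diff f pL2)
    have "L2sq M (?p f) = L2sq M (\<lambda>x. f x + - 1 * (f x - ?p f x))"
      by (intro L2sq_cong_AE) simp
    also have "\<dots> \<le> 2 * L2sq M f + 2 * L2sq M (\<lambda>x. - 1 * (f x - ?p f x))"
      using f d by (intro L2sq_add_le) (auto simp: L2_iff)
    also have "L2sq M (\<lambda>x. - 1 * (f x - ?p f x)) = L2sq M (\<lambda>x. f x - ?p f x)"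
      by (subst L2sq_scale) (use L2_diff[OF f pL2] in \<open>auto simp: L2_iff\<close>)
    also have "2 * L2sq M f + 2 * \<dots> \<le> 2 * L2sq M f + 2 * L2sq M f"
      by (intro add_mono mult_left_mono L2sq_diff_proj_le e f) auto
    also have "\<dots> = 4 * L2sq M f"
      by (simp add: distrib_right[symmetric])
    finally show ?thesis .
  qed
  have "bounded_op M F"
  proof (rule bounded_opI[where P = "P * 4"])
    fix f g a assume fg: "f \<in> L2 M" "g \<in> L2 M"
    show "F f \<in> borel_measurable M"
      unfolding F_def using bounded_op_L2[OF R pL2] by (simp add: L2_iff)
    show "AE x in M. F (\<lambda>x. a * f x + g x) x = a * F f x + F g x"
      unfolding F_def proj_linear[OF e fg] by (rule bounded_op_linear[OF R pL2 pL2])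
    have "L2sq M (F f) \<le> P * L2sq M (?p f)"
      unfolding F_def by (rule Rb[OF pL2])
    also have "\<dots> \<le> P * (4 * L2sq M f)"
      by (intro mult_left_mono p_le fg) auto
    finally show "L2sq M (F f) \<le> P * 4 * L2sq M f" by (simp add: mult.assoc)
  qed (use P in \<open>auto simp: ennreal_mult_less_top\<close>)
  moreover have "rank_less M F n"
    unfolding rank_less_def
  proof (intro exI[of _ m] conjI exI[of _ "\<lambda>i. R (e i)"] allI impI ballI)
    show "m < n" using Suc by simp
    show "R (e i) \<in> L2 M" if "i < m" for i
      using e that by (intro bounded_op_L2[OF R]) (auto simp: orthonormal_def)
    fix f
    show "\<exists>c. AE x in M. F f x = (\<Sum>i<m. c i * R (e i) x)"
      unfolding F_def proj_def using e
      by (intro exI[of _ "\<lambda>i. ip M f (e i)"] bounded_op_sum R) (auto simp: orthonormal_def)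
  qed
  ultimately obtain f where f: "f \<in> L2 M" "L2sq M f \<le> 1" "s < L2sq M (\<lambda>x. R f x - F f x)"
    using far by blast
  define g where "g = (\<lambda>x. f x - ?p f x)"
  have g: "g \<in> L2 M" unfolding g_def by (intro L2_diff f pL2)
  have "L2sq M (R g) = L2sq M (\<lambda>x. R f x - F f x)"
    unfolding F_def g_def by (intro L2sq_cong_AE bounded_op_diff R f pL2)
  with f have sg: "s < L2sq M (R g)" by simp
  have g1: "L2sq M g \<le> 1"
    using L2sq_diff_proj_le[OF e f(1)] f(2) by (simp add: g_def)
  \<comment> \<open>An image above \<open>s\<close> is not null, so boundedness of \<open>R\<close>
    shows that \<open>g\<close> can be normalized.\<close>
  have g0: "L2sq M g \<noteq> 0"
    using Rb[OF g] sg by auto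
  obtain a :: real where a: "1 \<le> a"
    "ip M (\<lambda>x. complex_of_real a * g x) (\<lambda>x. complex_of_real a * g x) = 1"
    using L2_normalize[OF g g1 g0] by blast
  define u where "u = (\<lambda>x. complex_of_real a * g x)"
  have u: "u \<in> L2 M" unfolding u_def by (rule L2_scale[OF g])
  have ue: "ip M u (e i) = 0" if "i < m" for i
    using ip_diff_proj[OF e f(1) that] unfolding u_def ip_scale_left by (simp add: g_def)
  have eu: "ip M (e i) u = 0" if "i < m" for i
    using ue[OF that] ip_cnj[of M u "e i"] by simp
  have "L2sq M (R u) = L2sq M (\<lambda>x. complex_of_real a * R g x)"
    unfolding u_def by (intro L2sq_cong_AE bounded_op_scale R g)
  also have "\<dots> = (ennreal \<bar>a\<bar>)\<^sup>2 * L2sq M (R g)"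
    using bounded_op_L2[OF R g] by (subst L2sq_scale) (auto simp: L2_iff)
  also have "\<dots> \<ge> 1 * L2sq M (R g)"
    using a(1) by (intro mult_right_mono) (auto simp: one_le_power)
  finally have "s < L2sq M (R u)" using sg by simp
  then show ?case
    using e es u ue eu a(2)
    by (intro exI[of _ "e(m := u)"])
      (auto simp: orthonormal_def less_Suc_eq u_def[symmetric])
qed

lemma sum_strict_mono_ennreal:
  fixes a b :: "nat \<Rightarrow> ennreal"
  assumes "0 < n" "\<And>i. i < n \<Longrightarrow> a i < b i"
  shows "(\<Sum>i<n. a i) < (\<Sum>i<n. b i)"
  using assms
proof (induction n rule: nat_induct_non_zero)
  case (Suc n)
  then show ?case by (simp add: add_strict_mono)
qed simp

context sigma_finite_measure
begin

interpretation MM: pair_sigma_finite M M ..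

lemma kop_measurable [measurable]:
  assumes [measurable]: "case_prod k \<in> borel_measurable (M \<Otimes>\<^sub>M M)" "f \<in> borel_measurable M"
  shows "kop M k f \<in> borel_measurable M"
proof -
  have "(\<lambda>x. \<integral>y. k x y * f y \<partial>M) \<in> borel_measurable M" by measurable
  then show ?thesis by (simp add: kop_def[abs_def])
qed

lemma kop_sq_le:
  assumes [measurable]: "case_prod k \<in> borel_measurable (M \<Otimes>\<^sub>M M)"
    and kb: "kbound M (\<lambda>x y. ennreal (cmod (k x y))) P" and f: "f \<in> borel_measurable M"
  shows "L2sq M (kop M k f) \<le> P * L2sq M f"
proof -
  note f[measurable]
  have "L2sq M (kop M k f) \<le> (\<integral>\<^sup>+x. (\<integral>\<^sup>+y. ennreal (cmod (k x y)) * ennreal (cmod (f y)) \<partial>M)\<^sup>2 \<partial>M)"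
    unfolding L2sq_def
  proof (intro nn_integral_mono power_mono)
    fix x assume [measurable]: "x \<in> space M"
    \<comment> \<open>Where the integral diverges, its default value 0 satisfies the bound
      trivially.\<close>
    have "ennreal (cmod (kop M k f x)) \<le> (\<integral>\<^sup>+y. ennreal (cmod (k x y * f y)) \<partial>M)"
      unfolding kop_def
      by (cases "integrable M (\<lambda>y. k x y * f y)")
        (auto simp: integral_norm_bound_ennreal not_integrable_integral_eq)
    then show "ennreal (cmod (kop M k f x)) \<le> (\<integral>\<^sup>+y. ennreal (cmod (k x y)) * ennreal (cmod (f y)) \<partial>M)"
      by (simp add: norm_mult ennreal_mult)
  qed auto
  also have "\<dots> \<le> P * (\<integral>\<^sup>+x. (ennreal (cmod (f x)))\<^sup>2 \<partial>M)"
    by (intro kboundD[OF kb]) measurable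
  finally show ?thesis by (simp add: L2sq_def)
qed

text \<open>The integral of the moduli is square integrable in \<open>x\<close>, hence finite almost
  everywhere.\<close>

lemma kop_converges:
  assumes [measurable]: "case_prod k \<in> borel_measurable (M \<Otimes>\<^sub>M M)"
    and kb: "kbound M (\<lambda>x y. ennreal (cmod (k x y))) P" and P: "P < \<infinity>" and f: "f \<in> L2 M"
  shows "AE x in M. integrable M (\<lambda>y. k x y * f y)"
proof -
  have [measurable]: "f \<in> borel_measurable M" using f by (simp add: L2_iff)
  let ?g = "\<lambda>x. (\<integral>\<^sup>+y. ennreal (cmod (k x y)) * ennreal (cmod (f y)) \<partial>M)"
  have "(\<integral>\<^sup>+x. (?g x)\<^sup>2 \<partial>M) \<le> P * L2sq M f"
    unfolding L2sq_def by (intro kboundD[OF kb]) measurable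
  also have "\<dots> < \<infinity>" using P f by (auto simp: L2_iff ennreal_mult_less_top)
  finally have "AE x in M. (?g x)\<^sup>2 \<noteq> \<infinity>"
    by (intro nn_integral_PInf_AE) auto
  then show ?thesis
  proof (rule AE_mp, intro AE_I2 impI)
    fix x assume [measurable]: "x \<in> space M" and "(?g x)\<^sup>2 \<noteq> \<infinity>"
    then have "?g x < \<infinity>" by (auto simp: power_eq_top_ennreal less_top)
    then show "integrable M (\<lambda>y. k x y * f y)"
      by (intro integrableI_bounded) (auto simp: norm_mult ennreal_mult)
  qed
qed

lemma bounded_op_kop:
  assumes k [measurable]: "case_prod k \<in> borel_measurable (M \<Otimes>\<^sub>M M)"
    and kb: "kbound M (\<lambda>x y. ennreal (cmod (k x y))) P" and P: "P < \<infinity>"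
  shows "bounded_op M (kop M k)"
proof (rule bounded_opI[OF _ _ kop_sq_le[OF k kb] P])
  fix f g a assume fg: "f \<in> L2 M" "g \<in> L2 M"
  then have [measurable]: "f \<in> borel_measurable M" by (simp add: L2_iff)
  then show "f \<in> borel_measurable M" "kop M k f \<in> borel_measurable M" by measurable
  \<comment> \<open>Additivity is only available where both integrals converge; elsewhere the
    default value 0 may violate it.\<close>
  show "AE x in M. kop M k (\<lambda>x. a * f x + g x) x = a * kop M k f x + kop M k g x"
    using kop_converges[OF k kb P fg(1)] kop_converges[OF k kb P fg(2)]
  proof eventually_elim
    case (elim x)
    have "kop M k (\<lambda>x. a * f x + g x) x = (\<integral>y. a * (k x y * f y) + k x y * g y \<partial>M)"
      by (simp add: kop_def algebra_simps)
    then show ?case using elim by (simp add: kop_def)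
  qed
qed

text \<open>Cauchy-Schwarz in \<open>y\<close> for each \<open>x\<close>. The bound may be infinite
  here; finiteness is supplied where the lemma is applied.\<close>

lemma kbound_hilbert_schmidt:
  assumes [measurable]: "case_prod \<kappa> \<in> borel_measurable (M \<Otimes>\<^sub>M M)"
  shows "kbound M \<kappa> (\<integral>\<^sup>+x. \<integral>\<^sup>+y. (\<kappa> x y)\<^sup>2 \<partial>M \<partial>M)"
  unfolding kbound_def
proof
  fix f :: "'a \<Rightarrow> ennreal" assume [measurable]: "f \<in> borel_measurable M"
  have "(\<integral>\<^sup>+x. (\<integral>\<^sup>+y. \<kappa> x y * f y \<partial>M)\<^sup>2 \<partial>M) \<le> (\<integral>\<^sup>+x. (\<integral>\<^sup>+y. (\<kappa> x y)\<^sup>2 \<partial>M) * (\<integral>\<^sup>+y. (f y)\<^sup>2 \<partial>M) \<partial>M)"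
    by (intro nn_integral_mono Cauchy_Schwarz_nn_integral) measurable
  also have "\<dots> = (\<integral>\<^sup>+x. \<integral>\<^sup>+y. (\<kappa> x y)\<^sup>2 \<partial>M \<partial>M) * (\<integral>\<^sup>+y. (f y)\<^sup>2 \<partial>M)"
    by (intro nn_integral_multc) measurable
  finally show "(\<integral>\<^sup>+x. (\<integral>\<^sup>+y. \<kappa> x y * f y \<partial>M)\<^sup>2 \<partial>M) \<le> (\<integral>\<^sup>+x. \<integral>\<^sup>+y. (\<kappa> x y)\<^sup>2 \<partial>M \<partial>M) * (\<integral>\<^sup>+y. (f y)\<^sup>2 \<partial>M)" .
qed

text \<open>For fixed \<open>x\<close>, the number \<open>kop M k (e i) x\<close> is the conjugate
  of the coefficient along \<open>e i\<close> of the conjugated row \<open>cnj (k x y)\<close>.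
  Bessel's inequality for each row, integrated over \<open>x\<close>, gives a bound independent of
  \<open>n\<close>.\<close>

lemma sum_kop_orthonormal_le:
  assumes [measurable]: "case_prod k \<in> borel_measurable (M \<Otimes>\<^sub>M M)" and e: "orthonormal M n e"
  shows "(\<Sum>i<n. L2sq M (kop M k (e i))) \<le> (\<integral>\<^sup>+x. \<integral>\<^sup>+y. (ennreal (cmod (k x y)))\<^sup>2 \<partial>M \<partial>M)"
proof -
  have em [measurable]: "e i \<in> borel_measurable M" if "i < n" for i
    using e that by (auto simp: orthonormal_def L2_iff)
  have "(\<Sum>i<n. L2sq M (kop M k (e i))) = (\<integral>\<^sup>+x. (\<Sum>i<n. (ennreal (cmod (kop M k (e i) x)))\<^sup>2) \<partial>M)"
    unfolding L2sq_def by (subst nn_integral_sum) auto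
  also have "\<dots> \<le> (\<integral>\<^sup>+x. \<integral>\<^sup>+y. (ennreal (cmod (k x y)))\<^sup>2 \<partial>M \<partial>M)"
  proof (rule nn_integral_mono)
    fix x assume [measurable]: "x \<in> space M"
    define u where "u = (\<lambda>y. cnj (k x y))"
    have um: "u \<in> borel_measurable M" unfolding u_def by measurable
    have L2u: "L2sq M u = (\<integral>\<^sup>+y. (ennreal (cmod (k x y)))\<^sup>2 \<partial>M)"
      by (simp add: L2sq_def u_def)
    have ipu: "cmod (kop M k (e i) x) = cmod (ip M u (e i))" for i
    proof -
      have "ip M u (e i) = cnj (kop M k (e i) x)"
        unfolding ip_def kop_def u_def by (subst Bochner_Integration.integral_cnj[symmetric]) simp
      then show ?thesis by simp
    qed
    show "(\<Sum>i<n. (ennreal (cmod (kop M k (e i) x)))\<^sup>2) \<le> (\<integral>\<^sup>+y. (ennreal (cmod (k x y)))\<^sup>2 \<partial>M)"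
    proof (cases "L2sq M u < \<infinity>")
      case True
      then have "u \<in> L2 M" using um by (simp add: L2_iff)
      from bessel_inequality[OF e this] show ?thesis
        by (simp add: ipu L2u ennreal_power)
    qed (simp add: L2u[symmetric] not_less top_unique)
  qed
  finally show ?thesis .
qed

text \<open>Otherwise there would be \<open>n\<close> orthonormal vectors whose images have squared
  norms above \<open>s\<close>, and the sum of these would exceed the Hilbert-Schmidt integral. In
  short, \<open>n\<close> times the square of the \<open>n\<close>-th approximation number is at
  most the squared Hilbert-Schmidt norm.\<close>

lemma hilbert_schmidt_approximation:
  assumes k [measurable]: "case_prod k \<in> borel_measurable (M \<Otimes>\<^sub>M M)"
    and hs: "(\<integral>\<^sup>+x. \<integral>\<^sup>+y. (ennreal (cmod (k x y)))\<^sup>2 \<partial>M \<partial>M) \<le> of_nat n * s" and s: "s < \<infinity>" and n: "0 < n"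
  shows "\<exists>F. bounded_op M F \<and> rank_less M F n \<and>
    (\<forall>f\<in>L2 M. L2sq M f \<le> 1 \<longrightarrow> L2sq M (\<lambda>x. kop M k f x - F f x) \<le> s)"
proof (rule ccontr)
  assume neg: "\<not> ?thesis"
  let ?P = "(\<integral>\<^sup>+x. \<integral>\<^sup>+y. (ennreal (cmod (k x y)))\<^sup>2 \<partial>M \<partial>M)"
  have P: "?P < \<infinity>"
    using s by (intro le_less_trans[OF hs]) (auto simp: ennreal_mult_less_top of_nat_less_top)
  have kb: "kbound M (\<lambda>x y. ennreal (cmod (k x y))) ?P"
    by (intro kbound_hilbert_schmidt) measurable
  have "\<exists>e. orthonormal M n e \<and> (\<forall>i<n. s < L2sq M (kop M k (e i)))"
  proof (rule finite_rank_or_orthonormal[OF bounded_op_kop[OF k kb P] kop_sq_le[OF k kb] P _ order_refl])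
    show "f \<in> borel_measurable M" if "f \<in> L2 M" for f using that by (simp add: L2_iff)
    show "\<exists>f\<in>L2 M. L2sq M f \<le> 1 \<and> s < L2sq M (\<lambda>x. kop M k f x - F f x)"
      if "bounded_op M F" "rank_less M F n" for F
      using neg that by (auto simp: not_le)
  qed
  then obtain e where e: "orthonormal M n e" "\<And>i. i < n \<Longrightarrow> s < L2sq M (kop M k (e i))"
    by blast
  have "of_nat n * s = (\<Sum>i<n. s)" by simp
  also have "\<dots> < (\<Sum>i<n. L2sq M (kop M k (e i)))"
    using n e(2) by (intro sum_strict_mono_ennreal) auto
  also have "\<dots> \<le> ?P" by (rule sum_kop_orthonormal_le[OF k e(1)])
  finally show False using hs by simp
qed

text \<open>Only the operator of \<open>k2\<close> is approximated by finite rank; the operator of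
  \<open>k1\<close> goes into the error as a whole.\<close>

lemma approx_number_kop_le:
  assumes k [measurable]: "case_prod k1 \<in> borel_measurable (M \<Otimes>\<^sub>M M)" "case_prod k2 \<in> borel_measurable (M \<Otimes>\<^sub>M M)"
    and kb: "kbound M (\<lambda>x y. ennreal (cmod (k1 x y))) (ennreal P)"
    and hs: "(\<integral>\<^sup>+x. \<integral>\<^sup>+y. (ennreal (cmod (k2 x y)))\<^sup>2 \<partial>M \<partial>M) \<le> of_nat n * ennreal Q"
    and n: "0 < n" and "0 \<le> P" "0 \<le> Q"
  shows "approx_number M n (kop M (\<lambda>x y. k1 x y + k2 x y)) \<le> ennreal (sqrt (2 * P + 2 * Q))"
proof -
  obtain F where F: "bounded_op M F" "rank_less M F n"
    "\<And>f. f \<in> L2 M \<Longrightarrow> L2sq M f \<le> 1 \<Longrightarrow> L2sq M (\<lambda>x. kop M k2 f x - F f x) \<le> ennreal Q"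
    using hilbert_schmidt_approximation[OF k(2) hs _ n] by auto
  have P2: "(\<integral>\<^sup>+x. \<integral>\<^sup>+y. (ennreal (cmod (k2 x y)))\<^sup>2 \<partial>M \<partial>M) < \<infinity>"
    by (rule le_less_trans[OF hs]) (auto simp: ennreal_mult_less_top of_nat_less_top)
  have kb2: "kbound M (\<lambda>x y. ennreal (cmod (k2 x y))) (\<integral>\<^sup>+x. \<integral>\<^sup>+y. (ennreal (cmod (k2 x y)))\<^sup>2 \<partial>M \<partial>M)"
    by (intro kbound_hilbert_schmidt) measurable
  have "op_norm M (\<lambda>f x. kop M (\<lambda>x y. k1 x y + k2 x y) f x - F f x) \<le> ennreal (sqrt (2 * P + 2 * Q))"
  proof (subst op_norm_le_iff, goal_cases)
    case 1 show ?case using assms by simp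
  next
    case 2
    show ?case
    proof (intro ballI impI)
      fix f assume f: "f \<in> L2 M" "L2sq M f \<le> 1"
      have [measurable]: "f \<in> borel_measurable M" "F f \<in> borel_measurable M"
        using f bounded_op_L2[OF F(1) f(1)] by (auto simp: L2_iff)
      have "L2sq M (\<lambda>x. kop M (\<lambda>x y. k1 x y + k2 x y) f x - F f x)
          = L2sq M (\<lambda>x. kop M k1 f x + (kop M k2 f x - F f x))"
      proof (rule L2sq_cong_AE)
        \<comment> \<open>The integral splits only where both pieces converge, which the two bounds
          guarantee almost everywhere.\<close>
        show "AE x in M. kop M (\<lambda>x y. k1 x y + k2 x y) f x - F f x = kop M k1 f x + (kop M k2 f x - F f x)"
          using kop_converges[OF k(1) kb _ f(1)] kop_converges[OF k(2) kb2 P2 f(1)]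
          by (auto simp: kop_def distrib_right)
      qed
      also have "\<dots> \<le> 2 * L2sq M (kop M k1 f) + 2 * L2sq M (\<lambda>x. kop M k2 f x - F f x)"
        by (rule L2sq_add_le) measurable
      also have "\<dots> \<le> 2 * ennreal P + 2 * ennreal Q"
      proof (intro add_mono mult_left_mono F f)
        have "L2sq M (kop M k1 f) \<le> ennreal P * L2sq M f"
          by (rule kop_sq_le[OF k(1) kb]) measurable
        also have "\<dots> \<le> ennreal P" using f(2) by (simp add: mult_left_le)
        finally show "L2sq M (kop M k1 f) \<le> ennreal P" .
      qed auto
      also have "\<dots> = ennreal ((sqrt (2 * P + 2 * Q))\<^sup>2)"
        using assms by (simp add: ennreal_mult)
      finally show "L2sq M (\<lambda>x. kop M (\<lambda>x y. k1 x y + k2 x y) f x - F f x) \<le> ennreal ((sqrt (2 * P + 2 * Q))\<^sup>2)" .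
    qed
  qed
  then show ?thesis
    unfolding approx_number_def using F by (intro INF_lower2[of F]) auto
qed

end

section \<open>Bounds for positive kernels\<close>

context sigma_finite_measure
begin

interpretation MM: pair_sigma_finite M M ..

text \<open>A Hajlasz gradient controls the commutator kernel only almost everywhere on the product.
  Fubini for null sets turns this into domination in \<open>y\<close> for almost every
  \<open>x\<close>, which is all that the iterated integral sees.\<close>

lemma kbound_mono_AE:
  assumes "kbound M \<kappa>' P" and le: "AE p in M \<Otimes>\<^sub>M M. \<kappa> (fst p) (snd p) \<le> \<kappa>' (fst p) (snd p)"
  shows "kbound M \<kappa> P"
  unfolding kbound_def
proof
  fix f :: "'a \<Rightarrow> ennreal" assume f: "f \<in> borel_measurable M"
  have "AE x in M. AE y in M. \<kappa> x y \<le> \<kappa>' x y"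
    using MM.AE_pair[OF le] by simp
  then have "AE x in M. (\<integral>\<^sup>+y. \<kappa> x y * f y \<partial>M)\<^sup>2 \<le> (\<integral>\<^sup>+y. \<kappa>' x y * f y \<partial>M)\<^sup>2"
  proof eventually_elim
    case (elim x)
    then have "AE y in M. \<kappa> x y * f y \<le> \<kappa>' x y * f y"
      by eventually_elim (simp add: mult_right_mono)
    then show ?case by (intro power_mono nn_integral_mono_AE) auto
  qed
  then have "(\<integral>\<^sup>+x. (\<integral>\<^sup>+y. \<kappa> x y * f y \<partial>M)\<^sup>2 \<partial>M) \<le> (\<integral>\<^sup>+x. (\<integral>\<^sup>+y. \<kappa>' x y * f y \<partial>M)\<^sup>2 \<partial>M)"
    by (rule nn_integral_mono_AE)
  then show "(\<integral>\<^sup>+x. (\<integral>\<^sup>+y. \<kappa> x y * f y \<partial>M)\<^sup>2 \<partial>M) \<le> P * (\<integral>\<^sup>+x. (f x)\<^sup>2 \<partial>M)"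
    using kboundD[OF assms(1) f] by order
qed

lemma kbound_add:
  assumes [measurable]: "case_prod \<kappa> \<in> borel_measurable (M \<Otimes>\<^sub>M M)" "case_prod \<kappa>' \<in> borel_measurable (M \<Otimes>\<^sub>M M)"
    and k: "kbound M \<kappa> P" "kbound M \<kappa>' Q"
  shows "kbound M (\<lambda>x y. \<kappa> x y + \<kappa>' x y) (2 * P + 2 * Q)"
  unfolding kbound_def
proof
  fix f :: "'a \<Rightarrow> ennreal" assume f [measurable]: "f \<in> borel_measurable M"
  have "(\<integral>\<^sup>+x. (\<integral>\<^sup>+y. (\<kappa> x y + \<kappa>' x y) * f y \<partial>M)\<^sup>2 \<partial>M)
      \<le> (\<integral>\<^sup>+x. 2 * (\<integral>\<^sup>+y. \<kappa> x y * f y \<partial>M)\<^sup>2 + 2 * (\<integral>\<^sup>+y. \<kappa>' x y * f y \<partial>M)\<^sup>2 \<partial>M)"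
  proof (rule nn_integral_mono)
    fix x assume [measurable]: "x \<in> space M"
    have "(\<integral>\<^sup>+y. (\<kappa> x y + \<kappa>' x y) * f y \<partial>M) = (\<integral>\<^sup>+y. \<kappa> x y * f y \<partial>M) + (\<integral>\<^sup>+y. \<kappa>' x y * f y \<partial>M)"
      by (simp add: distrib_right nn_integral_add)
    then show "(\<integral>\<^sup>+y. (\<kappa> x y + \<kappa>' x y) * f y \<partial>M)\<^sup>2
      \<le> 2 * (\<integral>\<^sup>+y. \<kappa> x y * f y \<partial>M)\<^sup>2 + 2 * (\<integral>\<^sup>+y. \<kappa>' x y * f y \<partial>M)\<^sup>2"
      by (simp add: square_sum_le_ennreal)
  qed
  also have "\<dots> = 2 * (\<integral>\<^sup>+x. (\<integral>\<^sup>+y. \<kappa> x y * f y \<partial>M)\<^sup>2 \<partial>M) + 2 * (\<integral>\<^sup>+x. (\<integral>\<^sup>+y. \<kappa>' x y * f y \<partial>M)\<^sup>2 \<partial>M)"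
    by (simp add: nn_integral_add nn_integral_cmult)
  also have "\<dots> \<le> 2 * (P * (\<integral>\<^sup>+x. (f x)\<^sup>2 \<partial>M)) + 2 * (Q * (\<integral>\<^sup>+x. (f x)\<^sup>2 \<partial>M))"
    by (intro add_mono mult_left_mono kboundD k f) auto
  finally show "(\<integral>\<^sup>+x. (\<integral>\<^sup>+y. (\<kappa> x y + \<kappa>' x y) * f y \<partial>M)\<^sup>2 \<partial>M) \<le> (2 * P + 2 * Q) * (\<integral>\<^sup>+x. (f x)\<^sup>2 \<partial>M)"
    by (simp add: distrib_right mult.assoc)
qed

lemma kbound_cmult:
  assumes [measurable]: "case_prod \<kappa> \<in> borel_measurable (M \<Otimes>\<^sub>M M)" and k: "kbound M \<kappa> P"
  shows "kbound M (\<lambda>x y. a * \<kappa> x y) (a\<^sup>2 * P)"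
  unfolding kbound_def
proof
  fix f :: "'a \<Rightarrow> ennreal" assume f [measurable]: "f \<in> borel_measurable M"
  have "(\<integral>\<^sup>+x. (\<integral>\<^sup>+y. a * \<kappa> x y * f y \<partial>M)\<^sup>2 \<partial>M) = (\<integral>\<^sup>+x. a\<^sup>2 * (\<integral>\<^sup>+y. \<kappa> x y * f y \<partial>M)\<^sup>2 \<partial>M)"
    by (intro nn_integral_cong) (simp add: mult.assoc nn_integral_cmult power_mult_distrib)
  also have "\<dots> = a\<^sup>2 * (\<integral>\<^sup>+x. (\<integral>\<^sup>+y. \<kappa> x y * f y \<partial>M)\<^sup>2 \<partial>M)"
    by (rule nn_integral_cmult) measurable
  also have "\<dots> \<le> a\<^sup>2 * (P * (\<integral>\<^sup>+x. (f x)\<^sup>2 \<partial>M))"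
    by (intro mult_left_mono kboundD k f) auto
  finally show "(\<integral>\<^sup>+x. (\<integral>\<^sup>+y. a * \<kappa> x y * f y \<partial>M)\<^sup>2 \<partial>M) \<le> a\<^sup>2 * P * (\<integral>\<^sup>+x. (f x)\<^sup>2 \<partial>M)"
    by (simp add: mult.assoc)
qed

section \<open>Geometric series, monotone limits and transposes of positive kernels\<close>

lemma suminf_half_power_ennreal: "(\<Sum>j. ennreal ((1 / 2) ^ j)) = 2"
proof -
  have "(\<lambda>j. ((1 / 2) ^ j :: real)) sums 2"
    using geometric_sums[of "1 / 2 :: real"] by simp
  then show ?thesis
    by (subst suminf_ennreal_eq[of _ 2]) auto
qed

text \<open>Cauchy-Schwarz for the counting measure, each weight being split into two square roots;
  the factor 2 is the total weight.\<close>

lemma weighted_suminf_square_le: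
  fixes a :: "nat \<Rightarrow> ennreal"
  shows "(\<Sum>j. ennreal ((1 / 2) ^ j) * a j)\<^sup>2 \<le> 2 * (\<Sum>j. ennreal ((1 / 2) ^ j) * (a j)\<^sup>2)"
proof -
  define w where "w j = ennreal (sqrt ((1 / 2) ^ j))" for j :: nat
  have w: "(w j)\<^sup>2 = ennreal ((1 / 2) ^ j)" for j
    by (simp add: w_def ennreal_power)
  have "(\<integral>\<^sup>+j. w j * (w j * a j) \<partial>count_space UNIV)\<^sup>2
      \<le> (\<integral>\<^sup>+j. (w j)\<^sup>2 \<partial>count_space UNIV) * (\<integral>\<^sup>+j. (w j * a j)\<^sup>2 \<partial>count_space UNIV)"
    by (rule Cauchy_Schwarz_nn_integral) auto
  then show ?thesis
    unfolding nn_integral_count_space_nat power_mult_distrib w suminf_half_power_ennreal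
      mult.assoc[symmetric] power2_eq_square[of "w _", symmetric] .
qed

text \<open>One factor 2 of the constant comes from Cauchy-Schwarz over \<open>j\<close>, the other
  from summing the weights once more.\<close>

lemma kbound_suminf:
  assumes [measurable]: "\<And>j. case_prod (\<kappa> j) \<in> borel_measurable (M \<Otimes>\<^sub>M M)"
    and k: "\<And>j. kbound M (\<kappa> j) P"
  shows "kbound M (\<lambda>x y. \<Sum>j. ennreal ((1 / 2) ^ j) * \<kappa> j x y) (4 * P)"
  unfolding kbound_def
proof
  fix f :: "'a \<Rightarrow> ennreal" assume f [measurable]: "f \<in> borel_measurable M"
  have "(\<integral>\<^sup>+x. (\<integral>\<^sup>+y. (\<Sum>j. ennreal ((1 / 2) ^ j) * \<kappa> j x y) * f y \<partial>M)\<^sup>2 \<partial>M)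
      \<le> (\<integral>\<^sup>+x. 2 * (\<Sum>j. ennreal ((1 / 2) ^ j) * (\<integral>\<^sup>+y. \<kappa> j x y * f y \<partial>M)\<^sup>2) \<partial>M)"
  proof (rule nn_integral_mono)
    fix x assume [measurable]: "x \<in> space M"
    have "(\<integral>\<^sup>+y. (\<Sum>j. ennreal ((1 / 2) ^ j) * \<kappa> j x y) * f y \<partial>M)
        = (\<Sum>j. \<integral>\<^sup>+y. ennreal ((1 / 2) ^ j) * (\<kappa> j x y * f y) \<partial>M)"
      by (subst nn_integral_suminf[symmetric]) (auto simp: mult.assoc[symmetric] ennreal_suminf_multc)
    also have "\<dots> = (\<Sum>j. ennreal ((1 / 2) ^ j) * (\<integral>\<^sup>+y. \<kappa> j x y * f y \<partial>M))"
      by (simp add: nn_integral_cmult)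
    finally show "(\<integral>\<^sup>+y. (\<Sum>j. ennreal ((1 / 2) ^ j) * \<kappa> j x y) * f y \<partial>M)\<^sup>2
        \<le> 2 * (\<Sum>j. ennreal ((1 / 2) ^ j) * (\<integral>\<^sup>+y. \<kappa> j x y * f y \<partial>M)\<^sup>2)"
      using weighted_suminf_square_le by simp
  qed
  also have "\<dots> = 2 * (\<Sum>j. ennreal ((1 / 2) ^ j) * (\<integral>\<^sup>+x. (\<integral>\<^sup>+y. \<kappa> j x y * f y \<partial>M)\<^sup>2 \<partial>M))"
    by (simp add: nn_integral_suminf nn_integral_cmult)
  also have "\<dots> \<le> 2 * (\<Sum>j. ennreal ((1 / 2) ^ j) * (P * (\<integral>\<^sup>+x. (f x)\<^sup>2 \<partial>M)))"
    by (intro mult_left_mono suminf_le kboundD k f) auto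
  also have "\<dots> = 4 * P * (\<integral>\<^sup>+x. (f x)\<^sup>2 \<partial>M)"
    by (simp add: ennreal_suminf_multc suminf_half_power_ennreal mult.assoc[symmetric])
  finally show "(\<integral>\<^sup>+x. (\<integral>\<^sup>+y. (\<Sum>j. ennreal ((1 / 2) ^ j) * \<kappa> j x y) * f y \<partial>M)\<^sup>2 \<partial>M)
      \<le> 4 * P * (\<integral>\<^sup>+x. (f x)\<^sup>2 \<partial>M)" .
qed

text \<open>Monotone convergence in \<open>y\<close> and then in \<open>x\<close>. This carries a
  bound from truncated radii to arbitrary ones with the same constant.\<close>

lemma kbound_LIMSEQ:
  assumes [measurable]: "\<And>n. case_prod (\<kappa> n) \<in> borel_measurable (M \<Otimes>\<^sub>M M)"
    and k: "\<And>n. kbound M (\<kappa> n) P"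
    and inc: "\<And>x y. incseq (\<lambda>n. \<kappa> n x y)" and lim: "\<And>x y. (\<lambda>n. \<kappa> n x y) \<longlonglongrightarrow> \<kappa>' x y"
  shows "kbound M \<kappa>' P"
  unfolding kbound_def
proof
  fix f :: "'a \<Rightarrow> ennreal" assume f [measurable]: "f \<in> borel_measurable M"
  have sup: "\<kappa>' x y = (SUP n. \<kappa> n x y)" for x y
    using LIMSEQ_unique[OF lim LIMSEQ_SUP[OF inc]] .
  let ?a = "\<lambda>n x. \<integral>\<^sup>+y. \<kappa> n x y * f y \<partial>M" and ?b = "\<lambda>x. \<integral>\<^sup>+y. \<kappa>' x y * f y \<partial>M"
  have inca: "incseq (\<lambda>n. ?a n x)" for x
    using inc by (intro incseq_SucI nn_integral_mono mult_right_mono) (auto simp: incseq_Suc_iff)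
  have lima: "(\<lambda>n. (?a n x)\<^sup>2) \<longlonglongrightarrow> (?b x)\<^sup>2" if [measurable]: "x \<in> space M" for x
  proof -
    have "?b x = (\<integral>\<^sup>+y. (SUP n. \<kappa> n x y * f y) \<partial>M)"
      by (simp add: sup SUP_mult_right_ennreal)
    also have "\<dots> = (SUP n. ?a n x)"
      using inc by (intro nn_integral_monotone_convergence_SUP)
        (auto simp: incseq_def le_fun_def intro!: mult_right_mono)
    finally have "(\<lambda>n. ?a n x) \<longlonglongrightarrow> ?b x"
      using LIMSEQ_SUP[OF inca] by simp
    then show ?thesis
      unfolding power2_eq_square by (intro tendsto_mult_ennreal) auto
  qed
  have inca2: "incseq (\<lambda>n. (?a n x)\<^sup>2)" for x
    using inca by (auto simp: incseq_def intro!: power_mono)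
  have "(\<integral>\<^sup>+x. (?b x)\<^sup>2 \<partial>M) = (\<integral>\<^sup>+x. (SUP n. (?a n x)\<^sup>2) \<partial>M)"
    by (intro nn_integral_cong LIMSEQ_unique[OF lima LIMSEQ_SUP[OF inca2]])
  also have "\<dots> = (SUP n. \<integral>\<^sup>+x. (?a n x)\<^sup>2 \<partial>M)"
    using inca2 by (intro nn_integral_monotone_convergence_SUP) (auto simp: incseq_def le_fun_def)
  also have "\<dots> \<le> P * (\<integral>\<^sup>+x. (f x)\<^sup>2 \<partial>M)"
    by (intro SUP_least kboundD k f)
  finally show "(\<integral>\<^sup>+x. (?b x)\<^sup>2 \<partial>M) \<le> P * (\<integral>\<^sup>+x. (f x)\<^sup>2 \<partial>M)" .
qed

text \<open>Duality: with \<open>T\<close> the operator of \<open>\<kappa>\<close> and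
  \<open>T'\<close> its transpose, \<open>|T' f|^2 = <f, T T' f> \<le> |f| |T| |T' f|\<close>, and
  one factor is cancelled. The bound \<open>Q\<close> supplies the finiteness that the cancellation
  requires.\<close>

lemma kbound_transpose:
  assumes [measurable]: "case_prod \<kappa> \<in> borel_measurable (M \<Otimes>\<^sub>M M)"
    and k: "kbound M \<kappa> P" and k': "kbound M (\<lambda>x y. \<kappa> y x) Q" and Q: "Q < \<infinity>" and P: "0 < P"
  shows "kbound M (\<lambda>x y. \<kappa> y x) P"
  unfolding kbound_def
proof
  fix f :: "'a \<Rightarrow> ennreal" assume f [measurable]: "f \<in> borel_measurable M"
  let ?I = "\<integral>\<^sup>+x. (f x)\<^sup>2 \<partial>M"
  define g where "g y = (\<integral>\<^sup>+x. \<kappa> x y * f x \<partial>M)" for y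
  define u where "u x = (\<integral>\<^sup>+y. \<kappa> x y * g y \<partial>M)" for x
  have [measurable]: "g \<in> borel_measurable M"
    unfolding g_def by measurable
  have [measurable]: "u \<in> borel_measurable M"
    unfolding u_def by measurable
  let ?G = "\<integral>\<^sup>+y. (g y)\<^sup>2 \<partial>M"
  have "?G \<le> P * ?I"
  proof (cases "?I < \<infinity>")
    case True
    have "?G \<le> Q * ?I" using kboundD[OF k' f] by (simp add: g_def)
    also have "\<dots> < \<infinity>" using True Q by (simp add: ennreal_mult_less_top)
    finally have fin: "?G < \<infinity>" .
    have "?G = (\<integral>\<^sup>+y. \<integral>\<^sup>+x. \<kappa> x y * f x * g y \<partial>M \<partial>M)"
    proof (rule nn_integral_cong)
      fix y assume [measurable]: "y \<in> space M"
      have "(\<integral>\<^sup>+x. \<kappa> x y * f x * g y \<partial>M) = (\<integral>\<^sup>+x. \<kappa> x y * f x \<partial>M) * g y"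
        by (rule nn_integral_multc) measurable
      then show "(g y)\<^sup>2 = (\<integral>\<^sup>+x. \<kappa> x y * f x * g y \<partial>M)"
        by (simp add: g_def power2_eq_square)
    qed
    also have "\<dots> = (\<integral>\<^sup>+x. \<integral>\<^sup>+y. \<kappa> x y * f x * g y \<partial>M \<partial>M)"
      by (rule MM.Fubini') measurable
    also have "\<dots> = (\<integral>\<^sup>+x. f x * u x \<partial>M)"
      unfolding u_def by (intro nn_integral_cong) (simp add: nn_integral_cmult[symmetric] ac_simps)
    finally have "?G\<^sup>2 = (\<integral>\<^sup>+x. f x * u x \<partial>M)\<^sup>2" by simp
    also have "\<dots> \<le> ?I * (\<integral>\<^sup>+x. (u x)\<^sup>2 \<partial>M)"
      by (rule Cauchy_Schwarz_nn_integral) measurable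
    also have "\<dots> \<le> ?I * (P * ?G)"
      unfolding u_def by (intro mult_left_mono kboundD[OF k]) auto
    finally have "?G * ?G \<le> ?G * (P * ?I)"
      by (simp add: power2_eq_square ac_simps)
    \<comment> \<open>A factor \<open>?G\<close> is cancelled, which requires it to be nonzero and
      finite.\<close>
    then show ?thesis
      using fin by (cases "?G = 0") (auto simp: ennreal_mult_le_mult_iff less_top)
  next
    case False
    \<comment> \<open>Since \<open>0 * \<top> = 0\<close> in \<open>ennreal\<close>, it is
      positivity of \<open>P\<close> that makes the right-hand side infinite.\<close>
    then show ?thesis using P by (simp add: ennreal_mult_top not_less top_unique)
  qed
  then show "(\<integral>\<^sup>+x. (\<integral>\<^sup>+y. \<kappa> y x * f y \<partial>M)\<^sup>2 \<partial>M) \<le> P * ?I"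
    by (simp add: g_def)
qed

text \<open>Schur's test with constant weights: Cauchy-Schwarz along a row produces
  \<open>A\<close>, and Fubini then leaves the measure of a column, at most
  \<open>B\<close>.\<close>

lemma kbound_indicator_schur:
  assumes [measurable]: "Measurable.pred (M \<Otimes>\<^sub>M M) (\<lambda>p. R (fst p) (snd p))"
    and A: "\<And>x. x \<in> space M \<Longrightarrow> emeasure M {y\<in>space M. R x y} \<le> A"
    and B: "\<And>y. y \<in> space M \<Longrightarrow> emeasure M {x\<in>space M. R x y} \<le> B"
  shows "kbound M (\<lambda>x y. of_bool (R x y)) (A * B)"
  unfolding kbound_def
proof
  fix f :: "'a \<Rightarrow> ennreal" assume f [measurable]: "f \<in> borel_measurable M"
  have [measurable]: "(\<lambda>p. of_bool (R (fst p) (snd p)) :: ennreal) \<in> borel_measurable (M \<Otimes>\<^sub>M M)"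
    unfolding of_bool_def by measurable
  have [measurable]: "Measurable.pred M (\<lambda>y. R x y)" "(\<lambda>y. of_bool (R x y) :: ennreal) \<in> borel_measurable M"
    if "x \<in> space M" for x
    using that measurable_compose[OF measurable_Pair1' assms(1)]
    unfolding of_bool_def by simp_all
  have [measurable]: "Measurable.pred M (\<lambda>x. R x y)" "(\<lambda>x. of_bool (R x y) :: ennreal) \<in> borel_measurable M"
    if "y \<in> space M" for y
    using that measurable_compose[OF measurable_Pair2' assms(1)]
    unfolding of_bool_def by simp_all
  have i1: "(\<integral>\<^sup>+y. (of_bool (R x y))\<^sup>2 \<partial>M) = emeasure M {y\<in>space M. R x y}" if x: "x \<in> space M" for x
  proof -
    have "(\<integral>\<^sup>+y. (of_bool (R x y))\<^sup>2 \<partial>M) = (\<integral>\<^sup>+y. indicator {y\<in>space M. R x y} y \<partial>M)"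
      by (intro nn_integral_cong) (auto simp: indicator_def)
    then show ?thesis using x by simp
  qed
  have i2: "(\<integral>\<^sup>+x. of_bool (R x y) \<partial>M) = emeasure M {x\<in>space M. R x y}" if y: "y \<in> space M" for y
  proof -
    have "(\<integral>\<^sup>+x. of_bool (R x y) \<partial>M) = (\<integral>\<^sup>+x. indicator {x\<in>space M. R x y} x \<partial>M)"
      by (intro nn_integral_cong) (auto simp: indicator_def)
    then show ?thesis using y by simp
  qed
  have "(\<integral>\<^sup>+x. (\<integral>\<^sup>+y. of_bool (R x y) * f y \<partial>M)\<^sup>2 \<partial>M) \<le> (\<integral>\<^sup>+x. A * (\<integral>\<^sup>+y. of_bool (R x y) * (f y)\<^sup>2 \<partial>M) \<partial>M)"
  proof (rule nn_integral_mono)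
    fix x assume x [measurable]: "x \<in> space M"
    \<comment> \<open>The indicator is written as its own square: one copy measures the row, the
      other stays with \<open>f\<close>.\<close>
    have "(\<integral>\<^sup>+y. of_bool (R x y) * f y \<partial>M) = (\<integral>\<^sup>+y. of_bool (R x y) * (of_bool (R x y) * f y) \<partial>M)"
      by (intro nn_integral_cong) auto
    also have "\<dots>\<^sup>2 \<le> (\<integral>\<^sup>+y. (of_bool (R x y))\<^sup>2 \<partial>M) * (\<integral>\<^sup>+y. (of_bool (R x y) * f y)\<^sup>2 \<partial>M)"
      by (rule Cauchy_Schwarz_nn_integral) (use x in measurable)
    also have "\<dots> \<le> A * (\<integral>\<^sup>+y. of_bool (R x y) * (f y)\<^sup>2 \<partial>M)"
      unfolding i1[OF x] using A[OF x]
      by (intro mult_mono nn_integral_mono) auto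
    finally show "(\<integral>\<^sup>+y. of_bool (R x y) * f y \<partial>M)\<^sup>2 \<le> A * (\<integral>\<^sup>+y. of_bool (R x y) * (f y)\<^sup>2 \<partial>M)" .
  qed
  also have "\<dots> = A * (\<integral>\<^sup>+x. \<integral>\<^sup>+y. of_bool (R x y) * (f y)\<^sup>2 \<partial>M \<partial>M)"
    by (rule nn_integral_cmult) measurable
  also have "(\<integral>\<^sup>+x. \<integral>\<^sup>+y. of_bool (R x y) * (f y)\<^sup>2 \<partial>M \<partial>M) = (\<integral>\<^sup>+y. \<integral>\<^sup>+x. of_bool (R x y) * (f y)\<^sup>2 \<partial>M \<partial>M)"
    by (rule MM.Fubini'[symmetric]) measurable
  also have "\<dots> \<le> (\<integral>\<^sup>+y. B * (f y)\<^sup>2 \<partial>M)"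
  proof (rule nn_integral_mono)
    fix y assume y [measurable]: "y \<in> space M"
    have "(\<integral>\<^sup>+x. of_bool (R x y) * (f y)\<^sup>2 \<partial>M) = emeasure M {x\<in>space M. R x y} * (f y)\<^sup>2"
      by (subst nn_integral_multc) (use y i2[OF y] in auto)
    then show "(\<integral>\<^sup>+x. of_bool (R x y) * (f y)\<^sup>2 \<partial>M) \<le> B * (f y)\<^sup>2"
      using B[OF y] by (simp add: mult_right_mono)
  qed
  also have "\<dots> = B * (\<integral>\<^sup>+y. (f y)\<^sup>2 \<partial>M)"
    by (rule nn_integral_cmult) measurable
  finally show "(\<integral>\<^sup>+x. (\<integral>\<^sup>+y. of_bool (R x y) * f y \<partial>M)\<^sup>2 \<partial>M) \<le> A * B * (\<integral>\<^sup>+y. (f y)\<^sup>2 \<partial>M)"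
    by (simp add: mult.assoc mult_left_mono)
qed

end

section \<open>Ahlfors regular spaces\<close>

locale ahlfors_space =
  fixes M :: "'a::metric_space measure" and d c0 C0 :: real
  assumes d_pos: "0 < d" and c0_pos: "0 < c0" and C0_pos: "0 < C0"
    and borel_subset: "sets borel \<subseteq> sets M"
    and ball_lower: "\<And>x r. 0 < r \<Longrightarrow> ennreal (c0 * r powr d) \<le> emeasure M (ball x r)"
    and ball_upper: "\<And>x r. 0 < r \<Longrightarrow> emeasure M (ball x r) \<le> ennreal (C0 * r powr d)"
begin

lemma space_M [simp]: "space M = UNIV"
  using borel_subset sets.sets_into_space[of UNIV M] space_in_borel by blast

lemma borel_sets_M: "A \<in> sets borel \<Longrightarrow> A \<in> sets M"
  using borel_subset by auto

lemma ball_sets [measurable, simp]: "ball x r \<in> sets M"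
  by (auto intro: borel_sets_M)

lemma borel_measurable_M: "f \<in> borel_measurable borel \<Longrightarrow> f \<in> borel_measurable M"
  using borel_subset by (auto simp: measurable_def)

lemma dist_measurable1 [measurable]: "(\<lambda>y. dist x y) \<in> borel_measurable M" "(\<lambda>y. dist y x) \<in> borel_measurable M"
  by (auto intro!: borel_measurable_M borel_measurable_continuous_onI continuous_intros)

sublocale sigma_finite_measure M
proof
  fix x0 :: 'a
  show "\<exists>A. countable A \<and> A \<subseteq> sets M \<and> \<Union> A = space M \<and> (\<forall>a\<in>A. emeasure M a \<noteq> \<infinity>)"
  proof (intro exI[of _ "range (\<lambda>n. ball x0 (real (Suc n)))"] conjI)
    have "\<exists>n. dist x0 x < real (Suc n)" for x
      using reals_Archimedean2[of "dist x0 x"] by (metis less_Suc_eq less_trans of_nat_less_iff)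
    then show "\<Union> (range (\<lambda>n. ball x0 (real (Suc n)))) = space M" by auto
    show "\<forall>a\<in>range (\<lambda>n. ball x0 (real (Suc n))). emeasure M a \<noteq> \<infinity>"
    proof clarify
      fix n assume "emeasure M (ball x0 (real (Suc n))) = \<infinity>"
      then show False using ball_upper[of "real (Suc n)" x0] by (simp add: top_unique)
    qed
  qed auto
qed

sublocale MM: pair_sigma_finite M M ..

text \<open>Packing: points at mutual distance at least \<open>e\<close> carry disjoint balls of
  radius \<open>e / 2\<close> whose measures are bounded below, all inside one ball of finite
  measure. Without a finite net, such a set could be enlarged point by point forever.\<close>

lemma finite_net:
  fixes x0 :: 'a
  assumes e: "0 < e"
  shows "\<exists>F. finite F \<and> ball x0 n \<subseteq> (\<Union>z\<in>F. ball z e)"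
proof (rule ccontr)
  assume neg: "\<not> ?thesis"
  define sep where "sep F \<longleftrightarrow> finite F \<and> F \<subseteq> ball x0 n \<and> (\<forall>x\<in>F. \<forall>y\<in>F. x \<noteq> y \<longrightarrow> e \<le> dist x y)" for F
  have "\<exists>F. sep F \<and> card F = k" for k
  proof (induction k)
    case 0 then show ?case by (intro exI[of _ "{}"]) (simp add: sep_def)
  next
    case (Suc k)
    then obtain F where F: "sep F" "card F = k" by blast
    then obtain z where z: "z \<in> ball x0 n" "z \<notin> (\<Union>z\<in>F. ball z e)"
      using neg unfolding sep_def by (meson subsetI)
    then have "z \<notin> F" using e by auto
    then show ?case
      using F z by (intro exI[of _ "insert z F"]) (auto simp: sep_def dist_commute not_less)
  qed
  \<comment> \<open>\<open>n\<close> is an arbitrary real here, and \<open>\<bar>n\<bar> + e\<close>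
    keeps the radius positive.\<close>
  moreover have "real (card F) * (c0 * (e / 2) powr d) \<le> C0 * (\<bar>n\<bar> + e) powr d" if F: "sep F" for F
  proof -
    have disj: "disjoint_family_on (\<lambda>z. ball z (e / 2)) F"
      unfolding disjoint_family_on_def
    proof (intro ballI impI)
      fix x y assume "x \<in> F" "y \<in> F" "x \<noteq> y"
      then have "e \<le> dist x y" using F by (auto simp: sep_def)
      then have False if "dist x u < e / 2" "dist y u < e / 2" for u
        using that dist_triangle2[of x y u] by simp
      then show "ball x (e / 2) \<inter> ball y (e / 2) = {}" by auto
    qed
    have "ennreal (real (card F) * (c0 * (e / 2) powr d)) = (\<Sum>z\<in>F. ennreal (c0 * (e / 2) powr d))"
      using c0_pos by (simp add: ennreal_mult ennreal_of_nat_eq_real_of_nat)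
    also have "\<dots> \<le> (\<Sum>z\<in>F. emeasure M (ball z (e / 2)))"
      using e by (intro sum_mono ball_lower) auto
    also have "\<dots> = emeasure M (\<Union>z\<in>F. ball z (e / 2))"
      using F disj by (intro sum_emeasure) (auto simp: sep_def)
    also have "\<dots> \<le> emeasure M (ball x0 (\<bar>n\<bar> + e))"
    proof (rule emeasure_mono)
      show "(\<Union>z\<in>F. ball z (e / 2)) \<subseteq> ball x0 (\<bar>n\<bar> + e)"
      proof
        fix u assume "u \<in> (\<Union>z\<in>F. ball z (e / 2))"
        then obtain z where "z \<in> F" "dist z u < e / 2" by auto
        moreover from this F have "dist x0 z < n" by (auto simp: sep_def)
        ultimately show "u \<in> ball x0 (\<bar>n\<bar> + e)"
          using dist_triangle[of x0 u z] e by simp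
      qed
    qed simp
    also have "\<dots> \<le> ennreal (C0 * (\<bar>n\<bar> + e) powr d)"
      using e by (intro ball_upper) auto
    finally show ?thesis using C0_pos by (simp add: ennreal_le_iff)
  qed
  ultimately have "real k * (c0 * (e / 2) powr d) \<le> C0 * (\<bar>n\<bar> + e) powr d" for k
    by metis
  moreover have "0 < c0 * (e / 2) powr d" using c0_pos e by simp
  ultimately show False
    by (metis reals_Archimedean3 not_less)
qed

section \<open>Separability and measurability of the distance\<close>

lemma countable_dense:
  obtains D :: "'a set" where "countable D" "\<And>x e. 0 < e \<Longrightarrow> \<exists>z\<in>D. dist x z < e"
proof -
  fix x0 :: 'a
  have "\<exists>F. finite F \<and> ball x0 (real n) \<subseteq> (\<Union>z\<in>F. ball z (1 / real (Suc m)))" for n m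
    by (rule finite_net) simp
  then obtain F where F: "\<And>n m. finite (F n m)"
    "\<And>n m. ball x0 (real n) \<subseteq> (\<Union>z\<in>F n m. ball z (1 / real (Suc m)))"
    by metis
  show ?thesis
  proof
    show "countable (\<Union>n m. F n m)" by (intro countable_UN countableI_type countable_finite F(1))
    fix x and e :: real assume "0 < e"
    then obtain m where m: "1 / real (Suc m) < e"
      using nat_approx_posE by blast
    obtain n where "dist x0 x < real n" using reals_Archimedean2 by blast
    with F(2)[of n m] obtain z where "z \<in> F n m" "dist z x < 1 / real (Suc m)" by auto
    with m show "\<exists>z\<in>\<Union>n m. F n m. dist x z < e"
      by (intro bexI[of _ z]) (auto simp: dist_commute)
  qed
qed

text \<open>Continuity alone is not enough, as a product \<sigma>-algebra may miss open sets when
  the space is not separable. A countable dense set turns \<open>dist x y < t\<close> into a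
  countable union of conditions on \<open>dist z x + dist z y\<close>, whose summands depend on one
  variable each.\<close>

lemma dist_measurable [measurable]: "(\<lambda>p. dist (fst p) (snd p)) \<in> borel_measurable (M \<Otimes>\<^sub>M M)"
proof -
  obtain D :: "'a set" where D: "countable D" "\<And>x e. 0 < e \<Longrightarrow> \<exists>z\<in>D. dist x z < e"
    using countable_dense by metis
  show ?thesis
  proof (rule borel_measurableI_less)
    fix t :: real
    have "{p \<in> space (M \<Otimes>\<^sub>M M). dist (fst p) (snd p) < t}
        = (\<Union>z\<in>D. {p \<in> space (M \<Otimes>\<^sub>M M). dist z (fst p) + dist z (snd p) < t})" (is "?L = ?R")
    proof
      show "?R \<subseteq> ?L"
        using dist_triangle3 by (auto intro: le_less_trans)
      show "?L \<subseteq> ?R"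
      proof clarsimp
        fix x y :: 'a assume "dist x y < t"
        \<comment> \<open>The detour through \<open>z\<close> costs \<open>dist x z\<close> twice,
          hence half of the slack.\<close>
        then obtain z where "z \<in> D" "dist x z < (t - dist x y) / 2"
          using D(2)[of "(t - dist x y) / 2" x] by auto
        moreover have "dist z y \<le> dist x z + dist x y"
          using dist_triangle3[of z y x] by simp
        ultimately show "\<exists>z\<in>D. dist z x + dist z y < t"
          by (intro bexI[of _ z]) (auto simp: dist_commute field_simps)
      qed
    qed
    also have "\<dots> \<in> sets (M \<Otimes>\<^sub>M M)"
    proof (rule sets.countable_UN'[OF D(1)], rule image_subsetI)
      fix z
      show "{p \<in> space (M \<Otimes>\<^sub>M M). dist z (fst p) + dist z (snd p) < t} \<in> sets (M \<Otimes>\<^sub>M M)"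
        by measurable
    qed
    finally show "{p \<in> space (M \<Otimes>\<^sub>M M). dist (fst p) (snd p) < t} \<in> sets (M \<Otimes>\<^sub>M M)" .
  qed
qed

section \<open>Averages over balls of variable radius\<close>

text \<open>The average over \<open>ball x (r x)\<close>, normalized by
  \<open>r x powr (- d)\<close>, which by regularity is comparable to the inverse of the measure of
  the ball. Radius 0 gives the zero kernel, so a point is switched off by setting its radius to
  0.\<close>

definition avk :: "('a \<Rightarrow> real) \<Rightarrow> 'a \<Rightarrow> 'a \<Rightarrow> ennreal" where
  "avk r x y = (if dist x y < r x then ennreal (r x powr (- d)) else 0)"

lemma avk_measurable [measurable]:
  assumes [measurable]: "r \<in> borel_measurable M"
  shows "(\<lambda>p. avk r (fst p) (snd p)) \<in> borel_measurable (M \<Otimes>\<^sub>M M)"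
    "(\<lambda>p. avk r (snd p) (fst p)) \<in> borel_measurable (M \<Otimes>\<^sub>M M)"
  unfolding avk_def dist_commute[of "snd _" "fst _"] by measurable

lemma avk_measurable' [measurable]:
  assumes [measurable]: "r \<in> borel_measurable M"
  shows "(\<lambda>(x, y). avk r x y) \<in> borel_measurable (M \<Otimes>\<^sub>M M)"
    "(\<lambda>(x, y). avk r y x) \<in> borel_measurable (M \<Otimes>\<^sub>M M)"
  using avk_measurable[OF assms] by (simp_all add: split_beta')

text \<open>A common point \<open>y\<close> forces \<open>dist x z < 2 * r x\<close>. The ball
  around \<open>z\<close>, the smaller one, has measure at most \<open>C0 * r z powr d\<close>; this
  cancels the normalization at \<open>z\<close> and leaves the one at \<open>x\<close>, which
  \<open>2 powr d\<close> converts to the doubled radius.\<close>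

lemma avk_compose_le1:
  assumes r: "\<And>x. 0 \<le> r x" and le: "r z \<le> r x"
  shows "(\<integral>\<^sup>+y. avk r x y * avk r z y \<partial>M) \<le> ennreal (C0 * 2 powr d) * avk (\<lambda>x. 2 * r x) x z"
proof (cases "0 < r z \<and> dist x z < 2 * r x")
  case True
  then have rz: "0 < r z" "0 < r x" using le by auto
  have "(\<integral>\<^sup>+y. avk r x y * avk r z y \<partial>M)
      \<le> (\<integral>\<^sup>+y. ennreal (r x powr (- d)) * ennreal (r z powr (- d)) * indicator (ball z (r z)) y \<partial>M)"
    by (intro nn_integral_mono) (auto simp: avk_def)
  also have "\<dots> = ennreal (r x powr (- d)) * ennreal (r z powr (- d)) * emeasure M (ball z (r z))"
    by (subst nn_integral_cmult_indicator) auto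
  also have "\<dots> \<le> ennreal (r x powr (- d)) * ennreal (r z powr (- d)) * ennreal (C0 * r z powr d)"
    by (intro mult_left_mono ball_upper rz) auto
  also have "\<dots> = ennreal (C0 * 2 powr d * (2 * r x) powr (- d))"
    using rz C0_pos by (simp add: ennreal_mult[symmetric] powr_mult powr_minus field_simps)
  also have "\<dots> = ennreal (C0 * 2 powr d) * avk (\<lambda>x. 2 * r x) x z"
    using True C0_pos by (simp add: avk_def ennreal_mult)
  finally show ?thesis .
next
  case False
  have "avk r x y * avk r z y = 0" for y
  proof (rule ccontr)
    assume "avk r x y * avk r z y \<noteq> 0"
    then have "dist x y < r x" "dist z y < r z" by (auto simp: avk_def split: if_splits)
    moreover have "dist x z \<le> dist x y + dist z y" by (rule dist_triangle2)
    moreover have "0 \<le> dist z y" by simp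
    ultimately show False using False le by linarith
  qed
  then show ?thesis by (simp del: mult_eq_0_iff)
qed

lemma avk_compose_le:
  assumes r: "\<And>x. 0 \<le> r x"
  shows "(\<integral>\<^sup>+y. avk r x y * avk r z y \<partial>M)
    \<le> ennreal (C0 * 2 powr d) * (avk (\<lambda>x. 2 * r x) x z + avk (\<lambda>x. 2 * r x) z x)"
proof (cases "r z \<le> r x")
  case True
  then show ?thesis
    using avk_compose_le1[OF r True] by (auto simp: distrib_left intro: order_trans add_increasing2)
next
  case False
  then have "(\<integral>\<^sup>+y. avk r z y * avk r x y \<partial>M) \<le> ennreal (C0 * 2 powr d) * avk (\<lambda>x. 2 * r x) z x"
    by (intro avk_compose_le1 r) auto
  then show ?thesis
    by (auto simp: distrib_left mult.commute intro: order_trans add_increasing)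
qed

text \<open>The \<open>TT\<^sup>*\<close> argument: by the composition estimate the bound of the transpose at radius \<open>r\<close>
  is controlled by the one at radius \<open>2 r\<close>, with a factor \<open>1 / 2\<close>.\<close>

lemma avk_transpose_step:
  assumes r: "\<And>x. 0 \<le> r x" and [measurable]: "r \<in> borel_measurable M"
    and g [measurable]: "g \<in> borel_measurable M"
  shows "2 * (\<integral>\<^sup>+y. (\<integral>\<^sup>+x. avk r x y * g x \<partial>M)\<^sup>2 \<partial>M)
    \<le> (ennreal (C0 * 2 powr (d + 1)))\<^sup>2 * (\<integral>\<^sup>+x. (g x)\<^sup>2 \<partial>M)
      + (\<integral>\<^sup>+y. (\<integral>\<^sup>+x. avk (\<lambda>x. 2 * r x) x y * g x \<partial>M)\<^sup>2 \<partial>M)"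
proof -
  let ?r = "\<lambda>x. 2 * r x"
  let ?D = "ennreal (C0 * 2 powr d)"
  define u where "u y = (\<integral>\<^sup>+x. avk ?r x y * g x \<partial>M)" for y
  have [measurable]: "u \<in> borel_measurable M" unfolding u_def by measurable
  have D: "2 * ?D = ennreal (C0 * 2 powr (d + 1))"
    using C0_pos by (simp add: powr_add ennreal_mult ac_simps)
  have "(\<integral>\<^sup>+x. \<integral>\<^sup>+z. ?D * (g z * (avk ?r x z * g x)) \<partial>M \<partial>M)
      = (\<integral>\<^sup>+z. \<integral>\<^sup>+x. ?D * (g z * (avk ?r x z * g x)) \<partial>M \<partial>M)"
    by (rule MM.Fubini'[symmetric]) measurable
  also have "\<dots> = (\<integral>\<^sup>+z. ?D * (g z * u z) \<partial>M)"
    unfolding u_def by (simp add: nn_integral_cmult)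
  finally have e1: "(\<integral>\<^sup>+x. \<integral>\<^sup>+z. ?D * (g z * (avk ?r x z * g x)) \<partial>M \<partial>M) = (\<integral>\<^sup>+z. ?D * (g z * u z) \<partial>M)" .
  have e2: "(\<integral>\<^sup>+x. \<integral>\<^sup>+z. ?D * (g x * (avk ?r z x * g z)) \<partial>M \<partial>M) = (\<integral>\<^sup>+z. ?D * (g z * u z) \<partial>M)"
    unfolding u_def by (simp add: nn_integral_cmult)
  have "(\<integral>\<^sup>+y. (\<integral>\<^sup>+x. avk r x y * g x \<partial>M)\<^sup>2 \<partial>M)
      = (\<integral>\<^sup>+y. \<integral>\<^sup>+x. \<integral>\<^sup>+z. g x * g z * (avk r x y * avk r z y) \<partial>M \<partial>M \<partial>M)"
  proof (rule nn_integral_cong)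
    fix y assume [measurable]: "y \<in> space M"
    show "(\<integral>\<^sup>+x. avk r x y * g x \<partial>M)\<^sup>2 = (\<integral>\<^sup>+x. \<integral>\<^sup>+z. g x * g z * (avk r x y * avk r z y) \<partial>M \<partial>M)"
      unfolding power2_eq_square
      by (simp add: nn_integral_cmult[symmetric] nn_integral_multc[symmetric] ac_simps)
  qed
  also have "\<dots> = (\<integral>\<^sup>+x. \<integral>\<^sup>+y. \<integral>\<^sup>+z. g x * g z * (avk r x y * avk r z y) \<partial>M \<partial>M \<partial>M)"
    by (rule MM.Fubini') measurable
  also have "\<dots> = (\<integral>\<^sup>+x. \<integral>\<^sup>+z. \<integral>\<^sup>+y. g x * g z * (avk r x y * avk r z y) \<partial>M \<partial>M \<partial>M)"
    by (intro nn_integral_cong MM.Fubini') measurable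
  also have "\<dots> = (\<integral>\<^sup>+x. \<integral>\<^sup>+z. g x * g z * (\<integral>\<^sup>+y. avk r x y * avk r z y \<partial>M) \<partial>M \<partial>M)"
    by (intro nn_integral_cong nn_integral_cmult) measurable
  also have "\<dots> \<le> (\<integral>\<^sup>+x. \<integral>\<^sup>+z. g x * g z * (?D * (avk ?r x z + avk ?r z x)) \<partial>M \<partial>M)"
    by (intro nn_integral_mono mult_left_mono avk_compose_le r) auto
  also have "\<dots> = (\<integral>\<^sup>+x. \<integral>\<^sup>+z. ?D * (g z * (avk ?r x z * g x)) + ?D * (g x * (avk ?r z x * g z)) \<partial>M \<partial>M)"
    by (simp add: algebra_simps)
  also have "\<dots> = (\<integral>\<^sup>+x. \<integral>\<^sup>+z. ?D * (g z * (avk ?r x z * g x)) \<partial>M \<partial>M)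
      + (\<integral>\<^sup>+x. \<integral>\<^sup>+z. ?D * (g x * (avk ?r z x * g z)) \<partial>M \<partial>M)"
    by (simp add: nn_integral_add)
  also have "\<dots> = (\<integral>\<^sup>+z. ?D * (g z * u z) \<partial>M) + (\<integral>\<^sup>+z. ?D * (g z * u z) \<partial>M)"
    unfolding e1 e2 ..
  finally have "2 * (\<integral>\<^sup>+y. (\<integral>\<^sup>+x. avk r x y * g x \<partial>M)\<^sup>2 \<partial>M) \<le> 2 * ((\<integral>\<^sup>+z. ?D * (g z * u z) \<partial>M) + (\<integral>\<^sup>+z. ?D * (g z * u z) \<partial>M))"
    by (rule mult_left_mono) simp
  also have "\<dots> = (\<integral>\<^sup>+z. 2 * ((2 * ?D) * g z * u z) \<partial>M)"
    by (simp add: nn_integral_cmult mult_2[symmetric] mult.assoc)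
  \<comment> \<open>All constants are put on \<open>g\<close>, so the square of \<open>u\<close> has
    coefficient 1 against the 2 on the left: this is the gain of \<open>1 / 2\<close> per
    doubling.\<close>
  also have "\<dots> \<le> (\<integral>\<^sup>+z. ((2 * ?D) * g z)\<^sup>2 + (u z)\<^sup>2 \<partial>M)"
    by (intro nn_integral_mono mult_le_squares_ennreal)
  also have "\<dots> = (2 * ?D)\<^sup>2 * (\<integral>\<^sup>+x. (g x)\<^sup>2 \<partial>M) + (\<integral>\<^sup>+z. (u z)\<^sup>2 \<partial>M)"
    by (simp add: nn_integral_add nn_integral_cmult power_mult_distrib)
  finally show ?thesis
    unfolding D by (simp add: u_def)
qed

text \<open>The nonzero radii lie between \<open>s\<close> and \<open>s * L\<close>, so the kernel
  is at most \<open>s powr (- d)\<close> times the indicator of \<open>dist x y < s * L\<close>, to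
  which Schur's test applies.\<close>

lemma avk_apriori:
  assumes [measurable]: "r \<in> borel_measurable M" and s: "0 < s" and L: "0 < L"
    and r: "\<And>x. r x = 0 \<or> s \<le> r x \<and> r x \<le> s * L"
  shows "kbound M (avk r) (ennreal ((C0 * L powr d)\<^sup>2))" "kbound M (\<lambda>x y. avk r y x) (ennreal ((C0 * L powr d)\<^sup>2))"
proof -
  let ?\<chi> = "\<lambda>x y. of_bool (dist x y < s * L) :: ennreal"
  let ?B = "ennreal (C0 * (s * L) powr d)"
  have \<chi>: "kbound M ?\<chi> (?B * ?B)"
  proof (rule kbound_indicator_schur)
    show "emeasure M {y \<in> space M. dist x y < s * L} \<le> ?B" for x
      using ball_upper[of "s * L" x] s L by (simp add: ball_def)
    show "emeasure M {y \<in> space M. dist y x < s * L} \<le> ?B" for x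
      using ball_upper[of "s * L" x] s L by (simp add: ball_def dist_commute)
  qed measurable
  have [measurable]: "case_prod ?\<chi> \<in> borel_measurable (M \<Otimes>\<^sub>M M)"
    unfolding split_beta' of_bool_def by measurable
  have "(ennreal (s powr (- d)))\<^sup>2 * (?B * ?B) = ennreal ((s powr (- d) * (C0 * (s * L) powr d))\<^sup>2)"
    using C0_pos by (simp add: ennreal_power ennreal_mult[symmetric] power2_eq_square ac_simps)
  \<comment> \<open>The powers of \<open>s\<close> cancel, so the bound is invariant under scaling
    of the radii.\<close>
  also have "s powr (- d) * (C0 * (s * L) powr d) = C0 * L powr d"
    using s L by (simp add: powr_mult powr_minus field_simps)
  finally have Q: "(ennreal (s powr (- d)))\<^sup>2 * (?B * ?B) = ennreal ((C0 * L powr d)\<^sup>2)" .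
  have kb: "kbound M (\<lambda>x y. ennreal (s powr (- d)) * ?\<chi> x y) (ennreal ((C0 * L powr d)\<^sup>2))"
    using kbound_cmult[OF _ \<chi>, of "ennreal (s powr (- d))"] unfolding Q by simp
  have le: "avk r x y \<le> ennreal (s powr (- d)) * ?\<chi> x y" for x y
  proof (cases "dist x y < r x")
    case True
    then have "0 < r x" by (rule le_less_trans[OF zero_le_dist])
    then have "s \<le> r x" "r x \<le> s * L" using r[of x] by auto
    then show ?thesis
      using True s d_pos by (auto simp: avk_def intro!: ennreal_leI powr_mono2')
  qed (simp add: avk_def)
  show "kbound M (avk r) (ennreal ((C0 * L powr d)\<^sup>2))"
    by (rule kbound_mono_AE[OF kb]) (simp add: le)
  show "kbound M (\<lambda>x y. avk r y x) (ennreal ((C0 * L powr d)\<^sup>2))"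
  proof (rule kbound_mono_AE[OF kb])
    show "AE p in M \<Otimes>\<^sub>M M. avk r (snd p) (fst p) \<le> ennreal (s powr (- d)) * ?\<chi> (fst p) (snd p)"
      using le by (subst dist_commute) simp
  qed
qed

text \<open>The fixed point of the recursion \<open>q = (avconst + q) / 2\<close> between the
  squared bounds at radii \<open>r\<close> and \<open>2 r\<close>; its value is the coefficient of
  the \<open>g\<close> term in \<open>avk_transpose_step\<close>.\<close>

definition avconst :: real where "avconst = (C0 * 2 powr (d + 1))\<^sup>2"

lemma avconst_pos: "0 < avconst"
  using C0_pos by (simp add: avconst_def)

text \<open>Doubling the radii replaces \<open>s\<close> by \<open>2 * s\<close> and keeps
  \<open>L\<close>. After \<open>k\<close> doublings the a priori bound is still the same, but it
  enters with weight \<open>(1 / 2) ^ k\<close>.\<close>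

lemma avk_transpose_iterate:
  assumes "r \<in> borel_measurable M" and "0 < s" and "0 < L"
    and "\<And>x. r x = 0 \<or> s \<le> r x \<and> r x \<le> s * L"
    and g: "g \<in> borel_measurable M"
  shows "(\<integral>\<^sup>+y. (\<integral>\<^sup>+x. avk r x y * g x \<partial>M)\<^sup>2 \<partial>M)
    \<le> ennreal (avconst + (1 / 2) ^ k * (C0 * L powr d)\<^sup>2) * (\<integral>\<^sup>+x. (g x)\<^sup>2 \<partial>M)"
  using assms(1,2,4)
proof (induction k arbitrary: r s)
  case 0
  have "(\<integral>\<^sup>+y. (\<integral>\<^sup>+x. avk r x y * g x \<partial>M)\<^sup>2 \<partial>M) \<le> ennreal ((C0 * L powr d)\<^sup>2) * (\<integral>\<^sup>+x. (g x)\<^sup>2 \<partial>M)"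
    by (rule kboundD[OF avk_apriori(2)[OF 0(1,2) assms(3) 0(3)] g])
  also have "\<dots> \<le> ennreal (avconst + (1 / 2) ^ 0 * (C0 * L powr d)\<^sup>2) * (\<integral>\<^sup>+x. (g x)\<^sup>2 \<partial>M)"
    using avconst_pos by (intro mult_right_mono ennreal_leI) auto
  finally show ?case .
next
  case (Suc k)
  let ?I = "\<integral>\<^sup>+x. (g x)\<^sup>2 \<partial>M" and ?Q = "(C0 * L powr d)\<^sup>2"
  let ?X = "\<integral>\<^sup>+y. (\<integral>\<^sup>+x. avk r x y * g x \<partial>M)\<^sup>2 \<partial>M"
  have r0: "0 \<le> r x" for x using Suc.prems(2) Suc.prems(3)[of x] by auto
  note Suc.prems(1)[measurable]
  have "(\<integral>\<^sup>+y. (\<integral>\<^sup>+x. avk (\<lambda>x. 2 * r x) x y * g x \<partial>M)\<^sup>2 \<partial>M) \<le> ennreal (avconst + (1 / 2) ^ k * ?Q) * ?I"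
    by (rule Suc.IH[where s = "2 * s"]) (use Suc.prems in auto)
  then have "2 * ?X \<le> ennreal avconst * ?I + ennreal (avconst + (1 / 2) ^ k * ?Q) * ?I"
    using avk_transpose_step[OF r0 Suc.prems(1) g] C0_pos
    by (simp add: avconst_def ennreal_power) (meson add_left_mono order_trans)
  also have "\<dots> = ennreal (2 * (avconst + (1 / 2) ^ Suc k * ?Q)) * ?I"
    using avconst_pos by (simp add: distrib_right[symmetric] flip: ennreal_plus)
  also have "\<dots> = 2 * (ennreal (avconst + (1 / 2) ^ Suc k * ?Q) * ?I)"
    using avconst_pos by (subst ennreal_mult) (auto simp: mult.assoc simp del: ennreal_plus power_Suc)
  finally show ?case
    by (simp add: ennreal_mult_le_mult_iff)
qed

text \<open>Letting \<open>k\<close> tend to infinity removes the a priori term for the transpose.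
  Duality then gives the bound for \<open>avk r\<close> itself, its a priori bound providing the
  finiteness that \<open>kbound_transpose\<close> asks for.\<close>

lemma kbound_avk_truncated:
  assumes r: "r \<in> borel_measurable M" and s: "0 < s" and L: "0 < L"
    and rs: "\<And>x. r x = 0 \<or> s \<le> r x \<and> r x \<le> s * L"
  shows "kbound M (\<lambda>x y. avk r y x) (ennreal avconst)" "kbound M (avk r) (ennreal avconst)"
proof -
  show 1: "kbound M (\<lambda>x y. avk r y x) (ennreal avconst)"
    unfolding kbound_def
  proof
    fix g :: "'a \<Rightarrow> ennreal" assume g: "g \<in> borel_measurable M"
    let ?I = "\<integral>\<^sup>+x. (g x)\<^sup>2 \<partial>M" and ?Q = "(C0 * L powr d)\<^sup>2"
    have "(\<lambda>k. ennreal (avconst + (1 / 2) ^ k * ?Q)) \<longlonglongrightarrow> ennreal (avconst + 0 * ?Q)"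
      by (intro tendsto_intros LIMSEQ_power_zero tendsto_ennrealI) auto
    then have "(\<lambda>k. ennreal (avconst + (1 / 2) ^ k * ?Q) * ?I) \<longlonglongrightarrow> ennreal avconst * ?I"
      using avconst_pos by (intro tendsto_mult_ennreal tendsto_const) auto
    then show "(\<integral>\<^sup>+x. (\<integral>\<^sup>+y. avk r y x * g y \<partial>M)\<^sup>2 \<partial>M) \<le> ennreal avconst * ?I"
      by (rule LIMSEQ_le_const) (intro exI allI impI avk_transpose_iterate[where s = s] r s L rs g)
  qed
  have "kbound M (\<lambda>x y. (\<lambda>x y. avk r y x) y x) (ennreal avconst)"
    by (rule kbound_transpose[OF _ 1 _ _]) (use avk_apriori(1)[OF r s L rs] avconst_pos r in \<open>auto intro: avk_measurable'\<close>)
  then show "kbound M (avk r) (ennreal avconst)" by simp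
qed

text \<open>Radii outside a compact range are set to 0 rather than clipped to its ends: clipping
  changes the height of the kernel and would destroy monotonicity in \<open>n\<close>, while
  switching points on one after the other yields an increasing sequence.\<close>

lemma kbound_avk:
  assumes r [measurable]: "r \<in> borel_measurable M" and r0: "\<And>x. 0 \<le> r x"
  shows "kbound M (avk r) (ennreal avconst)" "kbound M (\<lambda>x y. avk r y x) (ennreal avconst)"
proof -
  define \<rho> where "\<rho> n x = (if 1 / real (Suc n) \<le> r x \<and> r x \<le> real (Suc n) then r x else 0)" for n x
  have [measurable]: "\<rho> n \<in> borel_measurable M" for n
    unfolding \<rho>_def by measurable
  \<comment> \<open>Here \<open>s = 1 / Suc n\<close>, and \<open>L\<close> is the square of
    \<open>Suc n\<close>, so that \<open>s * L = Suc n\<close>.\<close>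
  have tr: "\<rho> n x = 0 \<or> 1 / real (Suc n) \<le> \<rho> n x \<and> \<rho> n x \<le> 1 / real (Suc n) * (real (Suc n))\<^sup>2" for n x
    by (auto simp: \<rho>_def power2_eq_square)
  have inc: "incseq (\<lambda>n. avk (\<rho> n) x y)" for x y
  proof (rule incseq_SucI)
    fix n
    have "1 / real (Suc (Suc n)) \<le> 1 / real (Suc n)" by (simp add: frac_le)
    then show "avk (\<rho> n) x y \<le> avk (\<rho> (Suc n)) x y"
      by (auto simp: avk_def \<rho>_def not_less)
  qed
  have lim: "(\<lambda>n. avk (\<rho> n) x y) \<longlonglongrightarrow> avk r x y" for x y
  proof (rule tendsto_eventually)
    show "\<forall>\<^sub>F n in sequentially. avk (\<rho> n) x y = avk r x y"
    proof (cases "r x = 0")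
      case True
      then show ?thesis by (simp add: avk_def \<rho>_def)
    next
      case False
      then have "0 < r x" using r0[of x] by simp
      then obtain n1 n2 where n: "1 / real (Suc n1) < r x" "r x < real n2"
        using nat_approx_posE reals_Archimedean2 by metis
      show ?thesis
      proof (rule eventually_sequentiallyI[of "max n1 n2"])
        fix n assume "max n1 n2 \<le> n"
        then have "1 / real (Suc n) \<le> 1 / real (Suc n1)" "real n2 \<le> real (Suc n)"
          by (auto simp: frac_le)
        with n have "\<rho> n x = r x" unfolding \<rho>_def by auto
        then show "avk (\<rho> n) x y = avk r x y" by (simp add: avk_def)
      qed
    qed
  qed
  have kb: "kbound M (\<lambda>x y. avk (\<rho> n) y x) (ennreal avconst)" "kbound M (avk (\<rho> n)) (ennreal avconst)" for n
    using kbound_avk_truncated[of "\<rho> n" "1 / real (Suc n)" "(real (Suc n))\<^sup>2", OF _ _ _ tr] by simp_all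
  show "kbound M (avk r) (ennreal avconst)"
    by (rule kbound_LIMSEQ[of "\<lambda>n. avk (\<rho> n)"]) (use kb inc lim in \<open>auto intro: avk_measurable'\<close>)
  show "kbound M (\<lambda>x y. avk r y x) (ennreal avconst)"
    by (rule kbound_LIMSEQ[of "\<lambda>n x y. avk (\<rho> n) y x"]) (use kb inc lim in \<open>auto intro: avk_measurable'\<close>)
qed

end

section \<open>Splitting the commutator kernel\<close>

lemma term_le_suminf_ennreal: "f j \<le> (\<Sum>i. f i)" for f :: "nat \<Rightarrow> ennreal"
  using sum_le_suminf[of f "{j}"] by simp

lemma ex_dyadic_scale:
  fixes x t :: real
  assumes "0 < x" "x < t"
  obtains j where "t * (1 / 2) ^ Suc j \<le> x" "x < t * (1 / 2) ^ j"
proof -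
  let ?P = "\<lambda>j. t * (1 / 2) ^ j \<le> x"
  have "0 < t" using assms by simp
  then obtain n where "(1 / 2) ^ n < x / t"
    using real_arch_pow_inv[of "x / t" "1 / 2"] assms by auto
  then have "?P n" using \<open>0 < t\<close> by (simp add: field_simps)
  then have L: "?P (LEAST j. ?P j)" by (rule LeastI)
  moreover have "(LEAST j. ?P j) \<noteq> 0"
  proof
    assume "(LEAST j. ?P j) = 0"
    with L have "?P 0" by metis
    with assms show False by simp
  qed
  then obtain j where j: "(LEAST j. ?P j) = Suc j" by (metis not0_implies_Suc)
  then have "\<not> ?P j" by (metis lessI not_less_Least)
  with L j show ?thesis by (intro that[of j]) auto
qed

context ahlfors_space
begin

text \<open>A fractional integral kernel of order 1, weighted by \<open>h x\<close> and cut off at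
  distance \<open>t / h x\<close> from \<open>x\<close>.\<close>

definition trk :: "real \<Rightarrow> ('a \<Rightarrow> real) \<Rightarrow> 'a \<Rightarrow> 'a \<Rightarrow> ennreal" where
  "trk t h x y = (if h x * dist x y < t then ennreal (h x * dist x y powr (1 - d)) else 0)"

lemma trk_measurable [measurable]:
  assumes [measurable]: "h \<in> borel_measurable M"
  shows "(\<lambda>(x, y). trk t h x y) \<in> borel_measurable (M \<Otimes>\<^sub>M M)"
    "(\<lambda>(x, y). trk t h y x) \<in> borel_measurable (M \<Otimes>\<^sub>M M)"
  unfolding trk_def split_beta' dist_commute[of "snd _" "fst _"] by measurable

text \<open>On the annulus \<open>R / 2 \<le> dist x y < R\<close> with
  \<open>h x * R = t * (1 / 2) ^ j\<close>, the kernel is comparable to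
  \<open>(h x * R) * R powr (- d)\<close>: the first factor is the geometric weight, the second the
  height of the average with radius \<open>R\<close>.\<close>

lemma trk_le_suminf_avk:
  assumes d: "1 < d" and t: "0 < t" and h: "0 \<le> h x"
  shows "trk t h x y \<le> ennreal (t * 2 powr d) * (\<Sum>j. ennreal ((1 / 2) ^ j) * avk (\<lambda>x. t * (1 / 2) ^ j / h x) x y)"
proof (cases "0 < h x \<and> 0 < dist x y \<and> h x * dist x y < t")
  case True
  then have hx: "0 < h x" and xy: "0 < dist x y" by auto
  obtain j where j: "t * (1 / 2) ^ Suc j \<le> h x * dist x y" "h x * dist x y < t * (1 / 2) ^ j"
    using True by (auto intro: ex_dyadic_scale[of "h x * dist x y" t])
  define R where "R = t * (1 / 2) ^ j / h x"
  have R: "0 < R" "R / 2 \<le> dist x y" "dist x y < R"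
    using j hx t by (auto simp: R_def field_simps)
  have hR: "h x * R = t * (1 / 2) ^ j"
    using hx by (simp add: R_def)
  \<comment> \<open>The exponent \<open>1 - d\<close> is negative, so the inner radius
    \<open>R / 2\<close> gives the upper bound.\<close>
  have "h x * dist x y powr (1 - d) \<le> h x * (R / 2) powr (1 - d)"
    using R d hx by (intro mult_left_mono powr_mono2') auto
  also have "\<dots> = h x * R * (R powr (- d) * (2 powr d / 2))"
    using R(1) by (simp add: powr_divide powr_diff powr_minus field_simps)
  also have "\<dots> \<le> h x * R * (R powr (- d) * 2 powr d)"
    using R(1) hx by (intro mult_left_mono) auto
  also have "\<dots> = t * 2 powr d * ((1 / 2) ^ j * R powr (- d))"
    unfolding hR by simp
  finally have "trk t h x y \<le> ennreal (t * 2 powr d * ((1 / 2) ^ j * R powr (- d)))"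
    by (simp add: trk_def ennreal_leI)
  also have "\<dots> = ennreal (t * 2 powr d) * (ennreal ((1 / 2) ^ j) * avk (\<lambda>x. t * (1 / 2) ^ j / h x) x y)"
    using R t by (simp add: avk_def R_def[symmetric] ennreal_mult)
  also have "\<dots> \<le> ennreal (t * 2 powr d) * (\<Sum>j. ennreal ((1 / 2) ^ j) * avk (\<lambda>x. t * (1 / 2) ^ j / h x) x y)"
    by (intro mult_left_mono term_le_suminf_ennreal) simp
  finally show ?thesis .
next
  case False
  \<comment> \<open>This includes the diagonal, where \<open>0 powr (1 - d) = 0\<close>.\<close>
  then have "trk t h x y = 0"
    using h by (auto simp: trk_def not_less)
  then show ?thesis by simp
qed

text \<open>The 4 comes from the geometric series in \<open>kbound_suminf\<close>, the square of
  \<open>2 powr d\<close> from the factor in the comparison with averages.\<close>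

definition trconst :: real where "trconst = 4 * (2 powr d)\<^sup>2 * avconst"

lemma trconst_pos: "0 < trconst"
  using avconst_pos by (simp add: trconst_def)

lemma kbound_trk:
  assumes d: "1 < d" and t: "0 < t" and h: "\<And>x. 0 \<le> h x" and hm [measurable]: "h \<in> borel_measurable M"
  shows "kbound M (trk t h) (ennreal (trconst * t\<^sup>2))" "kbound M (\<lambda>x y. trk t h y x) (ennreal (trconst * t\<^sup>2))"
proof -
  \<comment> \<open>Where \<open>h x = 0\<close>, the quotient is 0 by convention, and the average
    with radius 0 vanishes just as \<open>trk\<close> does.\<close>
  let ?r = "\<lambda>j x. t * (1 / 2) ^ j / h x"
  have rm [measurable]: "?r j \<in> borel_measurable M" for j by measurable
  have r0: "0 \<le> ?r j x" for j x using t h by simp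
  have c: "(ennreal (t * 2 powr d))\<^sup>2 * (4 * ennreal avconst) = ennreal (trconst * t\<^sup>2)"
  proof -
    have "(ennreal (t * 2 powr d))\<^sup>2 * (4 * ennreal avconst) = ennreal ((t * 2 powr d)\<^sup>2 * (4 * avconst))"
      using t avconst_pos by (subst ennreal_power) (auto simp: ennreal_mult)
    then show ?thesis by (simp add: trconst_def power_mult_distrib ac_simps)
  qed
  have m: "case_prod (\<lambda>x y. \<Sum>j. ennreal ((1 / 2) ^ j) * avk (?r j) x y) \<in> borel_measurable (M \<Otimes>\<^sub>M M)"
    "case_prod (\<lambda>x y. \<Sum>j. ennreal ((1 / 2) ^ j) * avk (?r j) y x) \<in> borel_measurable (M \<Otimes>\<^sub>M M)"
    unfolding split_beta' by measurable
  have "kbound M (\<lambda>x y. \<Sum>j. ennreal ((1 / 2) ^ j) * avk (?r j) x y) (4 * ennreal avconst)"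
    by (rule kbound_suminf) (intro avk_measurable' kbound_avk rm r0)+
  from kbound_cmult[OF m(1) this, of "ennreal (t * 2 powr d)"]
  show "kbound M (trk t h) (ennreal (trconst * t\<^sup>2))"
    unfolding c by (rule kbound_mono_AE) (intro AE_I2 trk_le_suminf_avk d t h)
  have "kbound M (\<lambda>x y. \<Sum>j. ennreal ((1 / 2) ^ j) * avk (?r j) y x) (4 * ennreal avconst)"
    by (rule kbound_suminf) (intro avk_measurable' kbound_avk rm r0)+
  from kbound_cmult[OF m(2) this, of "ennreal (t * 2 powr d)"]
  show "kbound M (\<lambda>x y. trk t h y x) (ennreal (trconst * t\<^sup>2))"
    unfolding c by (rule kbound_mono_AE) (intro AE_I2 trk_le_suminf_avk d t h)
qed

section \<open>Square integrals of the far part\<close>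

definition tailconst :: real where "tailconst = C0 * 2 powr d / (1 - 2 powr (2 - d))"

lemma tailconst_pos: "2 < d \<Longrightarrow> 0 < tailconst"
  using C0_pos powr_less_mono[of "2 - d" 0 2] by (simp add: tailconst_def)

text \<open>On the annulus from \<open>2^j s\<close> to \<open>2^(j+1) s\<close> the integrand is at
  most \<open>(2^j s)^(2 - 2 d)\<close>, and the outer ball has measure at most
  \<open>C0 * 2^d * (2^j s)^d\<close>. The products form a geometric series with ratio
  \<open>2 powr (2 - d)\<close>, which is below 1 because \<open>d > 2\<close>;
  \<open>tailconst\<close> is its sum at \<open>s = 1\<close>.\<close>

lemma tail_integral:
  assumes d: "2 < d" and s: "0 < s"
  shows "(\<integral>\<^sup>+y. (if s \<le> dist x y then ennreal (dist x y powr (2 - 2 * d)) else 0) \<partial>M) \<le> ennreal (tailconst * s powr (2 - d))"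
proof -
  let ?R = "\<lambda>j. s * 2 powr real j"
  let ?q = "2 powr (2 - d)"
  have q: "0 < ?q" "?q < 1" using powr_less_mono[of "2 - d" 0 2] d by auto
  have "(\<integral>\<^sup>+y. (if s \<le> dist x y then ennreal (dist x y powr (2 - 2 * d)) else 0) \<partial>M)
      \<le> (\<integral>\<^sup>+y. (\<Sum>j. ennreal (?R j powr (2 - 2 * d)) * indicator (ball x (?R j * 2)) y) \<partial>M)"
  proof (rule nn_integral_mono)
    fix y
    show "(if s \<le> dist x y then ennreal (dist x y powr (2 - 2 * d)) else 0)
        \<le> (\<Sum>j. ennreal (?R j powr (2 - 2 * d)) * indicator (ball x (?R j * 2)) y)"
    proof (cases "s \<le> dist x y")
      case True
      then have xy: "0 < dist x y" using s by linarith
      \<comment> \<open>\<open>s \<le> dist x y\<close> makes the logarithm nonnegative, so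
        \<open>nat\<close> loses nothing.\<close>
      define j where "j = nat \<lfloor>log 2 (dist x y / s)\<rfloor>"
      have "1 \<le> dist x y / s" using True s by simp
      then have "0 \<le> log 2 (dist x y / s)" by (subst zero_le_log_cancel_iff) auto
      then have j: "real j \<le> log 2 (dist x y / s)" "log 2 (dist x y / s) < real j + 1"
        unfolding j_def by linarith+
      have "2 powr real j \<le> dist x y / s" using j(1) xy s by (simp add: powr_le_iff)
      then have 1: "?R j \<le> dist x y" using s by (simp add: field_simps)
      have "dist x y / s < 2 powr (real j + 1)" using j(2) xy s by (simp add: less_powr_iff)
      then have 2: "dist x y < ?R j * 2" using s by (simp add: field_simps powr_add)
      have "ennreal (dist x y powr (2 - 2 * d)) \<le> ennreal (?R j powr (2 - 2 * d)) * indicator (ball x (?R j * 2)) y"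
        using 1 2 s d by (auto intro!: ennreal_leI powr_mono2')
      also have "\<dots> \<le> (\<Sum>j. ennreal (?R j powr (2 - 2 * d)) * indicator (ball x (?R j * 2)) y)"
        by (rule term_le_suminf_ennreal)
      finally show ?thesis using True by simp
    qed simp
  qed
  also have "\<dots> = (\<Sum>j. ennreal (?R j powr (2 - 2 * d)) * emeasure M (ball x (?R j * 2)))"
    by (simp add: nn_integral_suminf nn_integral_cmult)
  also have "\<dots> \<le> (\<Sum>j. ennreal (?R j powr (2 - 2 * d)) * ennreal (C0 * (?R j * 2) powr d))"
    using s by (intro suminf_le mult_left_mono ball_upper) auto
  also have "\<dots> = (\<Sum>j. ennreal (C0 * 2 powr d * s powr (2 - d) * ?q ^ j))"
  proof (rule suminf_cong)
    fix j :: nat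
    have "?R j powr (2 - 2 * d) * (C0 * (?R j * 2) powr d) = C0 * 2 powr d * (?R j powr (2 - 2 * d) * ?R j powr d)"
      using s by (simp add: powr_mult ac_simps)
    also have "?R j powr (2 - 2 * d) * ?R j powr d = ?R j powr (2 - d)"
      by (simp add: powr_add[symmetric])
    also have "\<dots> = s powr (2 - d) * ?q ^ j"
      using s by (simp add: powr_mult powr_powr mult.commute flip: powr_realpow)
    finally show "ennreal (?R j powr (2 - 2 * d)) * ennreal (C0 * (?R j * 2) powr d)
        = ennreal (C0 * 2 powr d * s powr (2 - d) * ?q ^ j)"
      using C0_pos by (simp add: ennreal_mult[symmetric] ac_simps)
  qed
  also have "\<dots> = ennreal (tailconst * s powr (2 - d))"
  proof (rule suminf_ennreal_eq)
    show "(\<lambda>j. C0 * 2 powr d * s powr (2 - d) * ?q ^ j) sums (tailconst * s powr (2 - d))"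
      using sums_mult[OF geometric_sums[of ?q], of "C0 * 2 powr d * s powr (2 - d)"] q
      by (simp add: tailconst_def)
  qed (use C0_pos in auto)
  finally show ?thesis .
qed

text \<open>The square of \<open>h x * dist x y powr (1 - d)\<close> on the region complementary to
  that of \<open>trk\<close>.\<close>

definition hsk :: "real \<Rightarrow> ('a \<Rightarrow> real) \<Rightarrow> 'a \<Rightarrow> 'a \<Rightarrow> ennreal" where
  "hsk t h x y = (if t \<le> h x * dist x y then ennreal ((h x)\<^sup>2 * dist x y powr (2 - 2 * d)) else 0)"

lemma hsk_measurable [measurable]:
  assumes [measurable]: "h \<in> borel_measurable M"
  shows "(\<lambda>(x, y). hsk t h x y) \<in> borel_measurable (M \<Otimes>\<^sub>M M)"
    "(\<lambda>(x, y). hsk t h y x) \<in> borel_measurable (M \<Otimes>\<^sub>M M)"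
  unfolding hsk_def split_beta' dist_commute[of "snd _" "fst _"] by measurable

text \<open>The tail starts at radius \<open>t / h x\<close>, and
  \<open>(h x)^2 * (t / h x)^(2 - d) = t^(2 - d) * (h x)^d\<close>: this is how the exponent
  \<open>d\<close> of the seminorm arises.\<close>

lemma hsk_integral:
  assumes d: "2 < d" and t: "0 < t" and h: "\<And>x. 0 \<le> h x" and hm [measurable]: "h \<in> borel_measurable M"
  shows "(\<integral>\<^sup>+x. \<integral>\<^sup>+y. hsk t h x y \<partial>M \<partial>M) \<le> ennreal (tailconst * t powr (2 - d)) * (\<integral>\<^sup>+x. ennreal (h x powr d) \<partial>M)"
proof -
  have "(\<integral>\<^sup>+x. \<integral>\<^sup>+y. hsk t h x y \<partial>M \<partial>M) \<le> (\<integral>\<^sup>+x. ennreal (tailconst * t powr (2 - d)) * ennreal (h x powr d) \<partial>M)"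
  proof (rule nn_integral_mono)
    fix x
    show "(\<integral>\<^sup>+y. hsk t h x y \<partial>M) \<le> ennreal (tailconst * t powr (2 - d)) * ennreal (h x powr d)"
    proof (cases "h x = 0")
      case True
      then show ?thesis using t by (simp add: hsk_def)
    next
      case False
      then have hx: "0 < h x" using h[of x] by simp
      have "(\<integral>\<^sup>+y. hsk t h x y \<partial>M) = (\<integral>\<^sup>+y. ennreal ((h x)\<^sup>2) * (if t / h x \<le> dist x y then ennreal (dist x y powr (2 - 2 * d)) else 0) \<partial>M)"
        using hx by (intro nn_integral_cong) (auto simp: hsk_def ennreal_mult field_simps)
      also have "\<dots> = ennreal ((h x)\<^sup>2) * (\<integral>\<^sup>+y. (if t / h x \<le> dist x y then ennreal (dist x y powr (2 - 2 * d)) else 0) \<partial>M)"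
        by (rule nn_integral_cmult) measurable
      also have "\<dots> \<le> ennreal ((h x)\<^sup>2) * ennreal (tailconst * (t / h x) powr (2 - d))"
        using hx t by (intro mult_left_mono tail_integral d) auto
      also have "\<dots> = ennreal (tailconst * t powr (2 - d) * h x powr d)"
        using hx t tailconst_pos[OF d]
        by (simp add: ennreal_mult[symmetric] powr_divide powr_diff field_simps)
      also have "\<dots> = ennreal (tailconst * t powr (2 - d)) * ennreal (h x powr d)"
        using tailconst_pos[OF d] by (simp add: ennreal_mult)
      finally show ?thesis .
    qed
  qed
  also have "\<dots> = ennreal (tailconst * t powr (2 - d)) * (\<integral>\<^sup>+x. ennreal (h x powr d) \<partial>M)"
    by (rule nn_integral_cmult) measurable
  finally show ?thesis .
qed

end

section \<open>The weak Schatten estimate\<close>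

context ahlfors_space
begin

text \<open>\<open>K\<close> is measurable only off the diagonal, but \<open>b x - b y\<close>
  vanishes on it, so \<open>K\<close> may be replaced by 0 there. Measurability of the diagonal
  itself rests on that of the distance.\<close>

lemma commutator_kernel_measurable:
  assumes "singular_kernel M K" and b [measurable]: "b \<in> borel_measurable M"
  shows "(\<lambda>(x, y). (b x - b y) * K x y) \<in> borel_measurable (M \<Otimes>\<^sub>M M)"
proof -
  let ?\<Omega> = "{(x, y). x \<noteq> y} :: ('a \<times> 'a) set"
  have \<Omega>: "?\<Omega> = {p \<in> space (M \<Otimes>\<^sub>M M). 0 < dist (fst p) (snd p)}"
    by (auto simp: space_pair_measure)
  have "{p \<in> space (M \<Otimes>\<^sub>M M). 0 < dist (fst p) (snd p)} \<in> sets (M \<Otimes>\<^sub>M M)"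
    by measurable
  then have "?\<Omega> \<inter> space (M \<Otimes>\<^sub>M M) \<in> sets (M \<Otimes>\<^sub>M M)"
    unfolding \<Omega>[symmetric] by (simp add: space_pair_measure)
  then have [measurable]: "(\<lambda>p. indicator ?\<Omega> p *\<^sub>R (\<lambda>(x, y). K x y) p) \<in> borel_measurable (M \<Otimes>\<^sub>M M)"
    using assms(1) by (subst borel_measurable_restrict_space_iff[symmetric]) (auto simp: singular_kernel_def)
  have "(\<lambda>p. (b (fst p) - b (snd p)) * (indicator ?\<Omega> p *\<^sub>R (\<lambda>(x, y). K x y) p)) \<in> borel_measurable (M \<Otimes>\<^sub>M M)"
    by measurable
  also have "(\<lambda>p. (b (fst p) - b (snd p)) * (indicator ?\<Omega> p *\<^sub>R (\<lambda>(x, y). K x y) p)) = (\<lambda>(x, y). (b x - b y) * K x y)"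
    by (auto simp: fun_eq_iff indicator_def)
  finally show ?thesis .
qed

lemma singular_kernel_bound:
  assumes "singular_kernel M K"
  obtains A where "0 < A" "\<And>x y. x \<noteq> y \<Longrightarrow> cmod (K x y) \<le> A * dist x y powr (- d)"
proof -
  obtain B where B: "0 < B" "\<And>x y. x \<noteq> y \<Longrightarrow> ennreal (cmod (K x y)) \<le> ennreal B / vol M x y"
    using assms by (auto simp: singular_kernel_def)
  show ?thesis
  proof (rule that[of "B / c0"])
    show "0 < B / c0" using B(1) c0_pos by simp
    fix x y :: 'a assume "x \<noteq> y"
    then have xy: "0 < dist x y" by simp
    \<comment> \<open>The upper ball bound makes the volume finite, so that the division takes place
      in the reals; the lower one gives the estimate.\<close>
    obtain v where v: "vol M x y = ennreal v" "0 \<le> v"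
      using ball_upper[OF xy, of x] by (cases "vol M x y") (auto simp: vol_def top_unique)
    have "c0 * dist x y powr d \<le> v"
      using ball_lower[OF xy, of x] v by (simp add: vol_def)
    moreover have "0 < c0 * dist x y powr d"
      using xy c0_pos by simp
    ultimately have "cmod (K x y) \<le> B / v" "B / v \<le> B / (c0 * dist x y powr d)"
      using B(2)[OF \<open>x \<noteq> y\<close>] v B(1) by (auto simp: divide_ennreal intro!: divide_left_mono)
    then show "cmod (K x y) \<le> B / c0 * dist x y powr (- d)"
      by (simp add: powr_minus field_simps)
  qed
qed

text \<open>The commutator enters only through the kernel bound \<open>le\<close>. With this
  threshold both \<open>P\<close> and \<open>Q\<close> are multiples of \<open>(A * t)^2\<close>.
  The second conclusion serves convergence and boundedness, for which any finite bound is
  enough.\<close>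

lemma approx_number_commutator_le:
  fixes k :: "'a \<Rightarrow> 'a \<Rightarrow> complex"
  assumes d: "2 < d" and k [measurable]: "case_prod k \<in> borel_measurable (M \<Otimes>\<^sub>M M)" and A: "0 < A"
    and h0: "\<And>x. 0 \<le> h x" and hm [measurable]: "h \<in> borel_measurable M"
    and le: "AE p in M \<Otimes>\<^sub>M M. cmod (k (fst p) (snd p)) \<le> A * (dist (fst p) (snd p) powr (1 - d) * (h (fst p) + h (snd p)))"
    and N: "0 < N" "(\<integral>\<^sup>+x. ennreal (h x powr d) \<partial>M) \<le> ennreal (N powr d)" and n: "0 < n"
  shows "approx_number M n (kop M k) \<le> ennreal (A * sqrt (8 * trconst + 16 * tailconst) * N * real n powr (- (1 / d)))"
    and "\<exists>P<\<infinity>. kbound M (\<lambda>x y. ennreal (cmod (k x y))) P"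
proof -
  define t where "t = N * real n powr (- (1 / d))"
  have t: "0 < t" using N n by (simp add: t_def)
  \<comment> \<open>On \<open>S\<close> each summand of the kernel bound is truncated with respect
    to its own variable, so the bound is exactly \<open>trk\<close> plus its transpose.\<close>
  define S where "S x y \<longleftrightarrow> h x * dist x y < t \<and> h y * dist x y < t" for x y
  define k1 where "k1 x y = (if S x y then k x y else 0)" for x y
  define k2 where "k2 x y = (if S x y then 0 else k x y)" for x y
  have k1m: "case_prod k1 \<in> borel_measurable (M \<Otimes>\<^sub>M M)" and k2m: "case_prod k2 \<in> borel_measurable (M \<Otimes>\<^sub>M M)"
    using k unfolding k1_def k2_def S_def split_beta' by measurable
  have kk: "k = (\<lambda>x y. k1 x y + k2 x y)"
    by (auto simp: fun_eq_iff k1_def k2_def)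
  note [measurable] = k1m k2m

  \<comment> \<open>The 4 is \<open>2 + 2\<close> from adding \<open>trk\<close> and its transpose,
    and the square of \<open>A\<close> comes from scaling.\<close>
  define P where "P = A\<^sup>2 * (4 * trconst * t\<^sup>2)"
  have P0: "0 \<le> P" using trconst_pos by (simp add: P_def)
  have kb1: "kbound M (\<lambda>x y. ennreal (cmod (k1 x y))) (ennreal P)"
  proof -
    have d1: "1 < d" using d by simp
    have m: "case_prod (\<lambda>x y. trk t h x y + trk t h y x) \<in> borel_measurable (M \<Otimes>\<^sub>M M)"
      using trk_measurable[OF hm, of t] by (simp add: split_beta')
    have kb: "kbound M (\<lambda>x y. ennreal A * (trk t h x y + trk t h y x))
        ((ennreal A)\<^sup>2 * (2 * ennreal (trconst * t\<^sup>2) + 2 * ennreal (trconst * t\<^sup>2)))"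
      by (intro kbound_cmult[OF m] kbound_add trk_measurable hm kbound_trk[OF d1 t h0 hm])
    have c: "(ennreal A)\<^sup>2 * (2 * ennreal (trconst * t\<^sup>2) + 2 * ennreal (trconst * t\<^sup>2)) = ennreal P"
    proof -
      have "2 * ennreal (trconst * t\<^sup>2) + 2 * ennreal (trconst * t\<^sup>2) = ennreal (4 * trconst * t\<^sup>2)"
        using trconst_pos by (simp add: distrib_right[symmetric] ennreal_mult mult.assoc)
      then show ?thesis
        using A trconst_pos unfolding P_def by (subst ennreal_mult) (auto simp: ennreal_power)
    qed
    show ?thesis
      using kb unfolding c
    proof (rule kbound_mono_AE)
      show "AE p in M \<Otimes>\<^sub>M M. ennreal (cmod (k1 (fst p) (snd p)))
          \<le> ennreal A * (trk t h (fst p) (snd p) + trk t h (snd p) (fst p))"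
        using le
      proof eventually_elim
        case (elim p)
        let ?x = "fst p" and ?y = "snd p"
        show ?case
        proof (cases "S ?x ?y")
          case True
          then have "trk t h ?x ?y + trk t h ?y ?x = ennreal (dist ?x ?y powr (1 - d) * (h ?x + h ?y))"
            using h0 by (simp add: trk_def S_def dist_commute algebra_simps)
          then have "ennreal A * (trk t h ?x ?y + trk t h ?y ?x) = ennreal (A * (dist ?x ?y powr (1 - d) * (h ?x + h ?y)))"
            using A h0 by (simp add: ennreal_mult)
          then show ?thesis using elim True by (simp add: k1_def ennreal_leI)
        qed (simp add: k1_def)
      qed
    qed
  qed

  \<comment> \<open>The 8 is \<open>4 * 2\<close>: \<open>(h x + h y)^2\<close> is at most 4 times
    the larger square, and \<open>hsk\<close> and its transpose contribute equally.\<close>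
  define Q where "Q = A\<^sup>2 * (8 * tailconst * t\<^sup>2)"
  have Q0: "0 \<le> Q" using tailconst_pos[OF d] by (simp add: Q_def)
  have hs: "(\<integral>\<^sup>+x. \<integral>\<^sup>+y. (ennreal (cmod (k2 x y)))\<^sup>2 \<partial>M \<partial>M) \<le> of_nat n * ennreal Q"
  proof -
    note [measurable] = hsk_measurable[OF hm, of t]
    let ?I = "\<integral>\<^sup>+x. \<integral>\<^sup>+y. hsk t h x y \<partial>M \<partial>M" and ?c = "ennreal (4 * A\<^sup>2)"
    have "AE p in M \<Otimes>\<^sub>M M. (ennreal (cmod (k2 (fst p) (snd p))))\<^sup>2 \<le> ?c * (hsk t h (fst p) (snd p) + hsk t h (snd p) (fst p))"
      using le
    proof eventually_elim
      case (elim p)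
      define x y where x_y_def: "x = fst p" "y = snd p"
      have elim: "cmod (k x y) \<le> A * (dist x y powr (1 - d) * (h x + h y))"
        using elim by (simp add: x_y_def)
      have main: "(ennreal (cmod (k x y)))\<^sup>2 \<le> ?c * ennreal (H\<^sup>2 * dist x y powr (2 - 2 * d))"
        if H: "h x \<le> H" "h y \<le> H" for H
      proof -
        have "cmod (k x y) \<le> A * (dist x y powr (1 - d) * (2 * H))"
          using elim by (rule order_trans) (use H A in \<open>intro mult_left_mono\<close>, auto)
        then have "(cmod (k x y))\<^sup>2 \<le> (A * (dist x y powr (1 - d) * (2 * H)))\<^sup>2"
          by (rule power_mono) simp
        also have "\<dots> = 4 * A\<^sup>2 * (H\<^sup>2 * (dist x y powr (1 - d))\<^sup>2)"
          by (simp add: power_mult_distrib ac_simps)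
        also have "(dist x y powr (1 - d))\<^sup>2 = dist x y powr (2 - 2 * d)"
          by (simp add: power2_eq_square powr_add[symmetric])
        finally have "ennreal ((cmod (k x y))\<^sup>2) \<le> ennreal (4 * A\<^sup>2 * (H\<^sup>2 * dist x y powr (2 - 2 * d)))"
          by (rule ennreal_leI)
        also have "\<dots> = ?c * ennreal (H\<^sup>2 * dist x y powr (2 - 2 * d))"
          by (rule ennreal_mult) auto
        finally show ?thesis by (simp add: ennreal_power)
      qed
      show ?case
        unfolding x_y_def[symmetric]
      proof (cases "S x y")
        case False
        \<comment> \<open>The larger of \<open>h x\<close> and \<open>h y\<close> carries the whole
          sum, and off \<open>S\<close> it lies in its own tail region.\<close>
        have "(ennreal (cmod (k x y)))\<^sup>2 \<le> ?c * hsk t h x y \<or> (ennreal (cmod (k x y)))\<^sup>2 \<le> ?c * hsk t h y x"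
        proof (cases "h x \<le> h y")
          case True
          then have "h x * dist x y \<le> h y * dist x y" by (simp add: mult_right_mono)
          then have "t \<le> h y * dist y x"
            using False by (auto simp: S_def dist_commute)
          then show ?thesis using main[of "h y"] True by (simp add: hsk_def dist_commute)
        next
          case False2: False
          then have "h y * dist x y \<le> h x * dist x y" by (simp add: mult_right_mono)
          then have "t \<le> h x * dist x y"
            using False by (auto simp: S_def)
          then show ?thesis using main[of "h x"] False2 by (simp add: hsk_def)
        qed
        then show "(ennreal (cmod (k2 x y)))\<^sup>2 \<le> ?c * (hsk t h x y + hsk t h y x)"
          using False by (auto simp: k2_def distrib_left intro: add_increasing add_increasing2)
      qed (simp add: k2_def)
    qed
    from MM.AE_pair[OF this]
    have "AE x in M. AE y in M. (ennreal (cmod (k2 x y)))\<^sup>2 \<le> ?c * (hsk t h x y + hsk t h y x)" by simp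
    then have "(\<integral>\<^sup>+x. \<integral>\<^sup>+y. (ennreal (cmod (k2 x y)))\<^sup>2 \<partial>M \<partial>M) \<le> (\<integral>\<^sup>+x. \<integral>\<^sup>+y. ?c * (hsk t h x y + hsk t h y x) \<partial>M \<partial>M)"
      by (intro nn_integral_mono_AE) (auto elim!: eventually_mono intro: nn_integral_mono_AE)
    also have "\<dots> = ?c * (?I + (\<integral>\<^sup>+x. \<integral>\<^sup>+y. hsk t h y x \<partial>M \<partial>M))"
      by (simp add: nn_integral_cmult nn_integral_add)
    also have "(\<integral>\<^sup>+x. \<integral>\<^sup>+y. hsk t h y x \<partial>M \<partial>M) = ?I"
      by (rule MM.Fubini') measurable
    also have "?c * (?I + ?I) = ennreal (8 * A\<^sup>2) * ?I"
    proof -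
      have "ennreal (8 * A\<^sup>2) = ?c + ?c" by (simp flip: ennreal_plus)
      then show ?thesis by (simp only: distrib_left distrib_right)
    qed
    also have "\<dots> \<le> ennreal (8 * A\<^sup>2) * (ennreal (tailconst * t powr (2 - d)) * ennreal (N powr d))"
      by (intro mult_left_mono order_trans[OF hsk_integral[OF d t h0 hm]] N(2)) auto
    also have "\<dots> = ennreal (8 * A\<^sup>2 * (tailconst * t powr (2 - d) * N powr d))"
      using tailconst_pos[OF d] by (simp add: ennreal_mult)
    also have "8 * A\<^sup>2 * (tailconst * t powr (2 - d) * N powr d) = real n * Q"
    proof -
      have "t powr d = N powr d * (1 / real n)"
      proof -
        have "t powr d = N powr d * (real n powr (- (1 / d))) powr d"
          unfolding t_def using N n by (subst powr_mult) auto
        also have "(real n powr (- (1 / d))) powr d = 1 / real n"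
          using n d unfolding powr_powr by (simp add: powr_minus_divide)
        finally show ?thesis .
      qed
      then have "N powr d = real n * t powr d" using n by simp
      moreover have "t powr (2 - d) * t powr d = t\<^sup>2"
        using t by (simp add: powr_add[symmetric])
      ultimately show ?thesis by (simp add: Q_def ac_simps)
    qed
    also have "ennreal (real n * Q) = of_nat n * ennreal Q"
      using Q0 by (simp add: ennreal_mult ennreal_of_nat_eq_real_of_nat)
    finally show ?thesis .
  qed

  have "approx_number M n (kop M k) \<le> ennreal (sqrt (2 * P + 2 * Q))"
    unfolding kk by (rule approx_number_kop_le[OF k1m k2m kb1 hs n P0 Q0])
  also have "2 * P + 2 * Q = (A * t)\<^sup>2 * (8 * trconst + 16 * tailconst)"
    by (simp add: P_def Q_def power_mult_distrib algebra_simps)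
  also have "sqrt \<dots> = A * sqrt (8 * trconst + 16 * tailconst) * N * real n powr (- (1 / d))"
    using A t by (simp add: real_sqrt_mult) (simp add: t_def)
  finally show "approx_number M n (kop M k) \<le> ennreal (A * sqrt (8 * trconst + 16 * tailconst) * N * real n powr (- (1 / d)))" .

  \<comment> \<open>The far part is bounded, being Hilbert-Schmidt, so the full kernel has a finite
    bound too.\<close>
  have kb2: "kbound M (\<lambda>x y. ennreal (cmod (k2 x y))) (\<integral>\<^sup>+x. \<integral>\<^sup>+y. (ennreal (cmod (k2 x y)))\<^sup>2 \<partial>M \<partial>M)"
    by (intro kbound_hilbert_schmidt) measurable
  have "kbound M (\<lambda>x y. ennreal (cmod (k1 x y)) + ennreal (cmod (k2 x y)))
      (2 * ennreal P + 2 * (\<integral>\<^sup>+x. \<integral>\<^sup>+y. (ennreal (cmod (k2 x y)))\<^sup>2 \<partial>M \<partial>M))"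
    by (intro kbound_add kb1 kb2) measurable
  then have "kbound M (\<lambda>x y. ennreal (cmod (k x y)))
      (2 * ennreal P + 2 * (\<integral>\<^sup>+x. \<integral>\<^sup>+y. (ennreal (cmod (k2 x y)))\<^sup>2 \<partial>M \<partial>M))"
    by (rule kbound_mono_AE) (auto simp: k1_def k2_def)
  moreover have "(\<integral>\<^sup>+x. \<integral>\<^sup>+y. (ennreal (cmod (k2 x y)))\<^sup>2 \<partial>M \<partial>M) < \<infinity>"
    by (rule le_less_trans[OF hs]) (auto simp: ennreal_mult_less_top of_nat_less_top)
  ultimately show "\<exists>P<\<infinity>. kbound M (\<lambda>x y. ennreal (cmod (k x y))) P"
    by (intro exI conjI) (auto simp: ennreal_mult_less_top)
qed

text \<open>Finiteness of \<open>Lnorm\<close> makes \<open>h\<close> finite almost everywhere, so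
  \<open>enn2real\<close>, which sends \<open>\<infinity>\<close> to 0, changes it only on a null
  set.\<close>

lemma finite_hajlasz_gradient:
  assumes d: "0 < d" and h: "hajlasz_upper_gradient M b h" and fin: "Lnorm M d h < \<infinity>"
  obtains h' where "\<And>x. 0 \<le> h' x" "h' \<in> borel_measurable M"
    "AE p in M \<Otimes>\<^sub>M M. cmod (b (fst p) - b (snd p)) \<le> dist (fst p) (snd p) * (h' (fst p) + h' (snd p))"
    "\<And>N. 0 < N \<Longrightarrow> Lnorm M d h \<le> ennreal N \<Longrightarrow> (\<integral>\<^sup>+x. ennreal (h' x powr d) \<partial>M) \<le> ennreal (N powr d)"
proof -
  have hm [measurable]: "h \<in> borel_measurable M"
    and hg: "AE (x, y) in M \<Otimes>\<^sub>M M. ennreal (cmod (b x - b y)) \<le> ennreal (dist x y) * (h x + h y)"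
    using h by (auto simp: hajlasz_upper_gradient_def)
  define h' where "h' x = enn2real (h x)" for x
  have [measurable]: "h' \<in> borel_measurable M" unfolding h'_def by measurable
  have h'0: "0 \<le> h' x" for x by (simp add: h'_def)
  let ?I = "\<integral>\<^sup>+x. enn_powr (h x) d \<partial>M"
  have pm: "(\<lambda>x. enn_powr (h x) d) \<in> borel_measurable M"
    unfolding enn_powr_def by measurable
  have I: "?I < \<infinity>"
    using fin by (auto simp: Lnorm_def enn_powr_def less_top split: if_splits)
  then have "AE x in M. enn_powr (h x) d \<noteq> \<infinity>"
    using nn_integral_PInf_AE[OF pm] by auto
  then have hfin: "AE x in M. h x < \<infinity>"
    by eventually_elim (auto simp: enn_powr_def less_top split: if_splits)
  have II: "(\<integral>\<^sup>+x. ennreal (h' x powr d) \<partial>M) = ?I"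
    using hfin by (intro nn_integral_cong_AE, eventually_elim) (auto simp: enn_powr_def h'_def)
  show ?thesis
  proof (rule that[of h'])
    show "0 \<le> h' x" for x by (rule h'0)
    show "h' \<in> borel_measurable M" by measurable
    have "AE x in M. AE y in M. h x < \<infinity> \<and> h y < \<infinity>"
      using hfin by eventually_elim (use hfin in auto)
    then have "AE p in M \<Otimes>\<^sub>M M. h (fst p) < \<infinity> \<and> h (snd p) < \<infinity>"
      by (intro MM.AE_pair_measure) auto
    then show "AE p in M \<Otimes>\<^sub>M M. cmod (b (fst p) - b (snd p)) \<le> dist (fst p) (snd p) * (h' (fst p) + h' (snd p))"
      using hg
    proof eventually_elim
      case (elim p)
      then have "h (fst p) = ennreal (h' (fst p))" "h (snd p) = ennreal (h' (snd p))"
        by (auto simp: h'_def)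
      with elim have "ennreal (cmod (b (fst p) - b (snd p))) \<le> ennreal (dist (fst p) (snd p) * (h' (fst p) + h' (snd p)))"
        by (simp add: split_beta' ennreal_mult h'0)
      then show ?case by (subst (asm) ennreal_le_iff) (auto simp: h'0)
    qed
    fix N :: real assume N: "0 < N" "Lnorm M d h \<le> ennreal N"
    obtain i where i: "?I = ennreal i" "0 \<le> i" using I by (cases ?I) auto
    have "i powr (1 / d) \<le> N"
      using N i by (simp add: Lnorm_def enn_powr_def)
    then have "(i powr (1 / d)) powr d \<le> N powr d"
      using d by (intro powr_mono2) auto
    then show "(\<integral>\<^sup>+x. ennreal (h' x powr d) \<partial>M) \<le> ennreal (N powr d)"
      unfolding II using i d by (simp add: powr_powr ennreal_leI)
  qed
qed

lemma commutator_eq_kop: "commutator M K b = kop M (\<lambda>x y. (b x - b y) * K x y)"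
  by (simp add: fun_eq_iff commutator_def kop_def)

text \<open>The estimate for approximation numbers asks for \<open>N > 0\<close>, while the norm of
  \<open>h\<close> may be 0. It is therefore applied with \<open>N\<close> slightly above the norm,
  and the excess tends to 0.\<close>

lemma weak_schatten_commutator:
  assumes d: "2 < d" and K: "singular_kernel M K" and A: "0 < A"
    and KA: "\<And>x y. x \<noteq> y \<Longrightarrow> cmod (K x y) \<le> A * dist x y powr (- d)"
    and b: "b \<in> borel_measurable M" and h: "hajlasz_upper_gradient M b h" and fin: "Lnorm M d h < \<infinity>"
  shows "weak_schatten_norm M d (commutator M K b) \<le> ennreal (A * sqrt (8 * trconst + 16 * tailconst)) * Lnorm M d h"
    and "commutator_converges M K b" and "bounded_op M (commutator M K b)"
proof -
  let ?k = "\<lambda>x y. (b x - b y) * K x y" and ?c = "A * sqrt (8 * trconst + 16 * tailconst)"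
  have c: "0 < ?c" using A trconst_pos tailconst_pos[OF d] by simp
  have km: "case_prod ?k \<in> borel_measurable (M \<Otimes>\<^sub>M M)"
    by (rule commutator_kernel_measurable[OF K b])
  obtain h' where h': "\<And>x. 0 \<le> h' x" "h' \<in> borel_measurable M"
    "AE p in M \<Otimes>\<^sub>M M. cmod (b (fst p) - b (snd p)) \<le> dist (fst p) (snd p) * (h' (fst p) + h' (snd p))"
    "\<And>N. 0 < N \<Longrightarrow> Lnorm M d h \<le> ennreal N \<Longrightarrow> (\<integral>\<^sup>+x. ennreal (h' x powr d) \<partial>M) \<le> ennreal (N powr d)"
    by (rule finite_hajlasz_gradient[OF d_pos h fin]) (rule that)
  have le: "AE p in M \<Otimes>\<^sub>M M. cmod (?k (fst p) (snd p)) \<le> A * (dist (fst p) (snd p) powr (1 - d) * (h' (fst p) + h' (snd p)))"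
    using h'(3)
  proof eventually_elim
    case (elim p)
    define x y where x_y_def: "x = fst p" "y = snd p"
    show ?case
      unfolding x_y_def[symmetric]
    proof (cases "x = y")
      case False
      have "cmod (?k x y) \<le> (dist x y * (h' x + h' y)) * (A * dist x y powr (- d))"
        unfolding norm_mult using elim h'(1)
        by (intro mult_mono KA[OF False]) (auto simp: x_y_def)
      also have "\<dots> = A * (dist x y powr (1 - d) * (h' x + h' y))"
        using False by (simp add: powr_diff powr_minus field_simps)
      finally show "cmod (?k x y) \<le> A * (dist x y powr (1 - d) * (h' x + h' y))" .
    \<comment> \<open>On the diagonal the commutator kernel is 0, whatever the value of
      \<open>K\<close>.\<close>
    qed (use A h'(1) in auto)
  qed
  obtain L where L: "Lnorm M d h = ennreal L" "0 \<le> L" using fin by (cases "Lnorm M d h") auto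
  note bound = approx_number_commutator_le[OF d km A h'(1,2) le _ h'(4)]
  show "weak_schatten_norm M d (commutator M K b) \<le> ennreal ?c * Lnorm M d h"
  proof (rule ennreal_le_epsilon)
    fix e :: real assume e: "0 < e"
    \<comment> \<open>Dividing by the constant makes the final error exactly
      \<open>e\<close>.\<close>
    define N where "N = L + e / ?c"
    have N: "0 < N" "L \<le> N" using L e c by (auto simp: N_def intro: add_nonneg_pos)
    show "weak_schatten_norm M d (commutator M K b) \<le> ennreal ?c * Lnorm M d h + ennreal e"
      unfolding weak_schatten_norm_def
    proof (rule SUP_least)
      fix n :: nat assume "n \<in> {1..}"
      then have n: "0 < n" by simp
      have "approx_number M n (commutator M K b) \<le> ennreal (?c * N * real n powr (- (1 / d)))"
        unfolding commutator_eq_kop using N L n by (intro bound) (auto intro: ennreal_leI)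
      then have "ennreal (real n powr (1 / d)) * approx_number M n (commutator M K b)
          \<le> ennreal (real n powr (1 / d)) * ennreal (?c * N * real n powr (- (1 / d)))"
        by (rule mult_left_mono) simp
      also have "\<dots> = ennreal (real n powr (1 / d) * (?c * N * real n powr (- (1 / d))))"
        using c N by (intro ennreal_mult[symmetric]) auto
      also have "real n powr (1 / d) * (?c * N * real n powr (- (1 / d))) = ?c * N"
        using n by (simp add: powr_minus)
      also have "?c * N = ?c * L + e"
        unfolding N_def distrib_left times_divide_eq_right using c
        by (subst nonzero_mult_div_cancel_left) auto
      also have "ennreal (?c * L + e) = ennreal ?c * Lnorm M d h + ennreal e"
        using c L e by (subst ennreal_plus) (auto simp: ennreal_mult'')
      finally show "ennreal (real n powr (1 / d)) * approx_number M n (commutator M K b)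
          \<le> ennreal ?c * Lnorm M d h + ennreal e" .
    qed
  qed
  have "\<exists>P<\<infinity>. kbound M (\<lambda>x y. ennreal (cmod (?k x y))) P"
    using L by (intro bound(2)[of "L + 1" 1]) (auto intro: ennreal_leI)
  then obtain P where P: "P < \<infinity>" "kbound M (\<lambda>x y. ennreal (cmod (?k x y))) P" by blast
  show "commutator_converges M K b"
    unfolding commutator_converges_def using kop_converges[OF km P(2,1)] by simp
  show "bounded_op M (commutator M K b)"
    unfolding commutator_eq_kop by (rule bounded_op_kop[OF km P(2,1)])
qed

end

theorem proposition6p4:
  fixes M :: "'a::metric_space measure" and d :: real and K :: "'a \<Rightarrow> 'a \<Rightarrow> complex"
  assumes "d > 2"
    and "ahlfors_regular M d"
    and "singular_kernel M K"
  shows "\<exists>C>0::real. \<forall>b \<in> borel_measurable M.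
           (hajlasz_norm M d b < \<infinity> \<longrightarrow>
              commutator_converges M K b \<and> bounded_op M (commutator M K b)) \<and>
           weak_schatten_norm M d (commutator M K b) \<le> ennreal C * hajlasz_norm M d b"
proof -
  obtain c0 C0 where "0 < c0" "0 < C0" and borel: "sets borel \<subseteq> sets M"
    and ball: "\<And>x r. 0 < r \<Longrightarrow> ennreal (c0 * r powr d) \<le> emeasure M (ball x r) \<and>
        emeasure M (ball x r) \<le> ennreal (C0 * r powr d)"
    using assms(2) unfolding ahlfors_regular_def by blast
  interpret ahlfors_space M d c0 C0
    by unfold_locales (use assms(1) \<open>0 < c0\<close> \<open>0 < C0\<close> borel ball in auto)
  obtain A where A: "0 < A" "\<And>x y. x \<noteq> y \<Longrightarrow> cmod (K x y) \<le> A * dist x y powr (- d)"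
    using singular_kernel_bound[OF assms(3)] by metis
  \<comment> \<open>\<open>A\<close> depends on \<open>K\<close> and the space, the other constants
    on the space alone; hence \<open>C\<close> is fixed before \<open>b\<close>.\<close>
  define C where "C = A * sqrt (8 * trconst + 16 * tailconst)"
  have C: "0 < C" using A(1) trconst_pos tailconst_pos[OF assms(1)] by (simp add: C_def)
  show ?thesis
  proof (intro exI[of _ C] conjI C ballI)
    fix b :: "'a \<Rightarrow> complex" assume b: "b \<in> borel_measurable M"
    note thms = weak_schatten_commutator[OF assms(1,3) A b, folded C_def]
    show "hajlasz_norm M d b < \<infinity> \<longrightarrow> commutator_converges M K b \<and> bounded_op M (commutator M K b)"
      using thms(2,3) by (auto simp: hajlasz_norm_def INF_less_iff)
    \<comment> \<open>After division by \<open>C\<close> the left side is a lower bound for the norm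
      of every gradient, so the infimum can be taken. Gradients of infinite norm satisfy it
      trivially, and an empty family has infimum \<open>\<infinity>\<close>.\<close>
    have "weak_schatten_norm M d (commutator M K b) / ennreal C \<le> Lnorm M d h"
      if h: "hajlasz_upper_gradient M b h" for h
    proof (cases "Lnorm M d h < \<infinity>")
      case True
      have "weak_schatten_norm M d (commutator M K b) / ennreal C \<le> ennreal C * Lnorm M d h / ennreal C"
        by (intro divide_right_mono_ennreal thms(1) h True)
      also have "\<dots> = Lnorm M d h"
        using C by (subst mult.commute) (simp add: ennreal_mult_divide_eq)
      finally show ?thesis .
    qed (simp add: not_less top_unique)
    then have "weak_schatten_norm M d (commutator M K b) / ennreal C \<le> hajlasz_norm M d b"
      unfolding hajlasz_norm_def by (auto intro: INF_greatest)
    then have "weak_schatten_norm M d (commutator M K b) / ennreal C * ennreal C \<le> hajlasz_norm M d b * ennreal C"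
      by (rule mult_right_mono) simp
    moreover have "u / ennreal C * ennreal C = u" for u
      using C by (simp add: divide_ennreal_def mult.assoc inverse_ennreal ennreal_mult[symmetric])
    ultimately show "weak_schatten_norm M d (commutator M K b) \<le> ennreal C * hajlasz_norm M d b"
      by (simp add: mult.commute)
  qed
qed

end
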